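(* Let $E,F$ be symmetric Banach function spaces on $I=(0,\infty)$ (or symmetric Banach sequence spaces) with the Fatou property such that the operator $H$ is bounded on $E$ and on $F$. Assume that $F$ factorizes through $E$, that is, $F=E\odot M(E,F)$. Then the Cesàro function (sequence) space $CF$ can be factorized by the Cesàro function (sequence) space $CE$, that is, $$CF=CE\odot M(CE,CF).$$
   Context: Equalities of spaces mean equality as sets with equivalent (quasi-)norms. $L^0(I)$ is the space of (classes of) real measurable functions on $I=(0,\infty)$ with Lebesgue measure $m$. A Banach ideal (function) space on $I$ is a linear subspace $E\subset L^0(I)$ with a complete norm such that $y\in E$, $x\in L^0$, $|x|\le|y|$ a.e. imply $x\in E$, $\|x\|_E\le\|y\|_E$; it is assumed to contain a weak unit (an element positive a.e.). It is symmetric if, whenever $x\in E$ and $y\in L^0$ have the same distribution function ($m\{|x|>\lambda\}=m\{|y|>\lambda\}$ for all $\lambda\ge0$), then $y\in E$ and $\|y\|_E=\|x\|_E$. $E$ has the Fatou property if $0\le x_n\uparrow x\in L^0$, $x_n\in E$, $\sup_n\|x_n\|_E<\infty$ imply $x\in E$ and $\|x_n\|_E\uparrow\|x\|_E$. In the sequence case, $I$ with Lebesgue measure is replaced by $\mathbb N=\{1,2,\dots\}$ with counting measure. $Hx(t)=\frac1t\int_0^tx(s)\,ds$ (in the sequence case $(Hx)_n=\frac1n\sum_{k=1}^nx_k$). $H$ is bounded on $E$ if it maps $E$ into $E$ with $\|Hx\|_E\le C\|x\|_E$. Product space: $E\odot F=\{xy:x\in E,y\in F\}$ with $\|u\|_{E\odot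 F}=\inf\{\|x\|_E\|y\|_F:u=xy,\,x\in E,\,y\in F\}$. Multipliers: $M(E,F)=\{x\in L^0:xy\in F\text{ for each }y\in E\}$ with $\|x\|_{M(E,F)}=\sup_{\|y\|_E=1}\|xy\|_F$. Cesàro space: $CE=\{f\in L^0:H|f|\in E\}$ with $\|f\|_{CE}=\|H|f|\|_E$. *)

theory Defs imports "HOL-Analysis.Analysis"
begin

text \<open>
  A normed space of (classes of) measurable functions: a set of representatives and a norm.
  The norm is meaningful only on the carrier. Classes modulo a.e. equality are not formed;
  instead, all carriers below are closed under a.e. equality, and their norms respect it
  (for Banach ideal spaces this is forced by the ideal property).
\<close>
datatype 'a fspace = FSpace (carr: "('a \<Rightarrow> real) set") (nrm: "('a \<Rightarrow> real) \<Rightarrow> real")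

definition banach_ideal_space :: "'a measure \<Rightarrow> 'a fspace \<Rightarrow> bool" where
  "banach_ideal_space \<mu> E \<longleftrightarrow>
     carr E \<subseteq> borel_measurable \<mu> \<and>
     (\<lambda>t. 0) \<in> carr E \<and>
     (\<forall>x\<in>carr E. \<forall>y\<in>carr E. (\<lambda>t. x t + y t) \<in> carr E) \<and>
     (\<forall>a. \<forall>x\<in>carr E. (\<lambda>t. a * x t) \<in> carr E) \<and>
     (\<forall>x\<in>carr E. 0 \<le> nrm E x) \<and>
     (\<forall>x\<in>carr E. nrm E x = 0 \<longleftrightarrow> (AE t in \<mu>. x t = 0)) \<and>
     (\<forall>a. \<forall>x\<in>carr E. nrm E (\<lambda>t. a * x t) = \<bar>a\<bar> * nrm E x) \<and>
     (\<forall>x\<in>carr E. \<forall>y\<in>carr E. nrm E (\<lambda>t. x t + y t) \<le> nrm E x + nrm E y) \<and>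
     (\<forall>X. (\<forall>n. X n \<in> carr E) \<and>
          (\<forall>e>0. \<exists>N::nat. \<forall>m\<ge>N. \<forall>n\<ge>N. nrm E (\<lambda>t. X m t - X n t) < e) \<longrightarrow>
          (\<exists>x\<in>carr E. (\<lambda>n. nrm E (\<lambda>t. X n t - x t)) \<longlonglongrightarrow> 0)) \<and>
     (\<forall>y\<in>carr E. \<forall>x\<in>borel_measurable \<mu>.
          (AE t in \<mu>. \<bar>x t\<bar> \<le> \<bar>y t\<bar>) \<longrightarrow> x \<in> carr E \<and> nrm E x \<le> nrm E y) \<and>
     (\<exists>w\<in>carr E. AE t in \<mu>. 0 < w t)"

definition equimeasurable :: "'a measure \<Rightarrow> ('a \<Rightarrow> real) \<Rightarrow> ('a \<Rightarrow> real) \<Rightarrow> bool" where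
  "equimeasurable \<mu> x y \<longleftrightarrow>
     (\<forall>l\<ge>0. emeasure \<mu> {t \<in> space \<mu>. \<bar>x t\<bar> > l} = emeasure \<mu> {t \<in> space \<mu>. \<bar>y t\<bar> > l})"

definition symmetric_banach_space :: "'a measure \<Rightarrow> 'a fspace \<Rightarrow> bool" where
  "symmetric_banach_space \<mu> E \<longleftrightarrow>
     banach_ideal_space \<mu> E \<and>
     (\<forall>x\<in>carr E. \<forall>y\<in>borel_measurable \<mu>.
        equimeasurable \<mu> x y \<longrightarrow> y \<in> carr E \<and> nrm E y = nrm E x)"

definition fatou_property :: "'a measure \<Rightarrow> 'a fspace \<Rightarrow> bool" where
  "fatou_property \<mu> E \<longleftrightarrow>
     (\<forall>X. \<forall>x\<in>borel_measurable \<mu>.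
        (\<forall>n. X n \<in> carr E) \<and>
        (AE t in \<mu>. (\<forall>n. 0 \<le> X n t) \<and> incseq (\<lambda>n. X n t) \<and> (\<lambda>n. X n t) \<longlonglongrightarrow> x t) \<and>
        bdd_above (range (\<lambda>n. nrm E (X n))) \<longrightarrow>
        x \<in> carr E \<and> incseq (\<lambda>n. nrm E (X n)) \<and> (\<lambda>n. nrm E (X n)) \<longlonglongrightarrow> nrm E x)"

definition same_space :: "'a fspace \<Rightarrow> 'a fspace \<Rightarrow> bool" where
  "same_space E F \<longleftrightarrow>
     carr E = carr F \<and>
     (\<exists>c>0. \<exists>C>0. \<forall>x\<in>carr E. c * nrm E x \<le> nrm F x \<and> nrm F x \<le> C * nrm E x)"

definition product_space :: "'a measure \<Rightarrow> 'a fspace \<Rightarrow> 'a fspace \<Rightarrow> 'a fspace" where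
  "product_space \<mu> E F = FSpace
     {u \<in> borel_measurable \<mu>. \<exists>x\<in>carr E. \<exists>y\<in>carr F. AE t in \<mu>. u t = x t * y t}
     (\<lambda>u. Inf {nrm E x * nrm F y | x y.
                 x \<in> carr E \<and> y \<in> carr F \<and> (AE t in \<mu>. u t = x t * y t)})"

text \<open>
  For Banach ideal spaces the supremum below is over a nonempty set that is bounded by the
  closed graph theorem, so the real-valued \<^const>\<open>Sup\<close> is the intended one.
\<close>
definition multipliers :: "'a measure \<Rightarrow> 'a fspace \<Rightarrow> 'a fspace \<Rightarrow> 'a fspace" where
  "multipliers \<mu> E F = FSpace
     {x \<in> borel_measurable \<mu>. \<forall>y\<in>carr E. (\<lambda>t. x t * y t) \<in> carr F}
     (\<lambda>x. Sup {nrm F (\<lambda>t. x t * y t) | y. y \<in> carr E \<and> nrm E y = 1})"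

subsection \<open>Functions on the half-line\<close>

abbreviation half_line :: "real measure" where
  "half_line \<equiv> lebesgue_on {0<..}"

definition hardy :: "(real \<Rightarrow> real) \<Rightarrow> real \<Rightarrow> real" where
  "hardy x t = (1 / t) * (LINT s:{0<..<t}|lebesgue. x s)"

text \<open>
  The Bochner integral of a non-integrable function is 0 by convention, so integrability,
  i.e. that the Hardy operator is defined (with finite values), has to be demanded explicitly.
\<close>
definition hardy_defined :: "(real \<Rightarrow> real) \<Rightarrow> bool" where
  "hardy_defined x \<longleftrightarrow> (\<forall>t>0. set_integrable lebesgue {0<..<t} x)"

definition hardy_bounded :: "real fspace \<Rightarrow> bool" where
  "hardy_bounded E \<longleftrightarrow>
     (\<forall>x\<in>carr E. hardy_defined x \<and> hardy x \<in> carr E) \<and>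
     (\<exists>C. \<forall>x\<in>carr E. nrm E (hardy x) \<le> C * nrm E x)"

definition cesaro :: "real fspace \<Rightarrow> real fspace" where
  "cesaro E = FSpace
     {f \<in> borel_measurable half_line.
        hardy_defined (\<lambda>s. \<bar>f s\<bar>) \<and> hardy (\<lambda>s. \<bar>f s\<bar>) \<in> carr E}
     (\<lambda>f. nrm E (hardy (\<lambda>s. \<bar>f s\<bar>)))"

subsection \<open>Sequences\<close>

text \<open>
  Sequences are indexed from 1: the value at 0 is outside the underlying space and plays no role.
\<close>
abbreviation pos_nats :: "nat measure" where
  "pos_nats \<equiv> count_space {1..}"

definition hardy_seq :: "(nat \<Rightarrow> real) \<Rightarrow> nat \<Rightarrow> real" where
  "hardy_seq x n = (1 / real n) * (\<Sum>k=1..n. x k)"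

definition hardy_seq_bounded :: "nat fspace \<Rightarrow> bool" where
  "hardy_seq_bounded E \<longleftrightarrow>
     (\<forall>x\<in>carr E. hardy_seq x \<in> carr E) \<and>
     (\<exists>C. \<forall>x\<in>carr E. nrm E (hardy_seq x) \<le> C * nrm E x)"

definition cesaro_seq :: "nat fspace \<Rightarrow> nat fspace" where
  "cesaro_seq E = FSpace
     {f \<in> borel_measurable pos_nats. hardy_seq (\<lambda>k. \<bar>f k\<bar>) \<in> carr E}
     (\<lambda>f. nrm E (hardy_seq (\<lambda>k. \<bar>f k\<bar>)))"

end

theory Submission imports Defs
begin

text \<open>
  Given \<open>f\<close> in \<open>CF\<close>, the least decreasing majorant \<open>p\<close> of \<open>H\<bar>f\<bar>\<close> still lies in \<open>F\<close>, because
  \<open>H\<bar>f\<bar>(s) \<le> 2 H\<bar>f\<bar>(u)\<close> for \<open>s \<le> u \<le> 2s\<close>. Factor \<open>p = g h\<close> with \<open>g\<close> in \<open>E\<close> and \<open>h\<close> in \<open>M(E,F)\<close>,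
  and let \<open>w(t)\<close> be essentially the decreasing rearrangement of \<open>h\<close> at \<open>t/2\<close>. For each \<open>t\<close>, \<open>\<bar>h\<bar> \<le> 2w(t)\<close>
  on at least half of \<open>(0,t)\<close>, and there \<open>\<bar>g\<bar> \<ge> p(t) / 2w(t)\<close>; hence \<open>p \<le> 4 w H\<bar>g\<bar>\<close>. Since \<open>w\<close> decreases,
  \<open>H(\<bar>f\<bar>/w) \<le> H\<bar>f\<bar>/w \<le> 4 H\<bar>g\<bar>\<close>, so \<open>f/w\<close> is in \<open>CE\<close>. Finally \<open>w\<close> is in \<open>M(CE,CF)\<close>: for \<open>y\<close> in \<open>CE\<close>
  with decreasing majorant \<open>q\<close> of \<open>H\<bar>y\<bar>\<close>, the integrals of \<open>\<bar>y\<bar>\<close> over initial segments are dominated by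
  those of \<open>q\<close>, so \<open>H(w\<bar>y\<bar>) \<le> H(wq)\<close> by Hardy's lemma, and \<open>wq\<close> is in \<open>F\<close> because \<open>q\<close> decreases.
\<close>

subsection \<open>Ideal spaces and multipliers\<close>

text \<open>The argument t/2 of the weight is forced by \<open>h\<close> being possibly large
  anywhere in (0,t). The set where |h| exceeds a level above its rearrangement at t/2 has measure at
  most t/2, so at least half of (0,t) is left for a lower bound on |g|. The price is a dilation, and
  the boundedness of \<open>H\<close> on \<open>F\<close> pays for it: if v decreases, then v(t/2)
  \<le> Hv(t/2) \<le> 2 Hv(t). The factor 2 in 2w(t) appears because the supremum that defines a
  rearrangement need not be attained. With half of this supremum as the weight, the level set of |h|
  at the weight is large enough, and every level above twice the weight is rare enough.
  \<open>w\<close> is only shown to multiply decreasing elements of \<open>E\<close> into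
  \<open>F\<close>. This suffices because the norm of \<open>CE\<close> sees y only through H|y|,
  whose decreasing majorant stands in for y. The reverse inclusion comes from the definition of a
  multiplier, with norm constant 1, once the multiplier norm is known to be a finite
  supremum.\<close>

locale ideal_fspace =
  fixes \<mu> :: "'a measure" and E :: "'a fspace"
  assumes meas: "x \<in> carr E \<Longrightarrow> x \<in> borel_measurable \<mu>"
    and nrm_nonneg: "x \<in> carr E \<Longrightarrow> 0 \<le> nrm E x"
    and nrm_zero_iff: "x \<in> carr E \<Longrightarrow> nrm E x = 0 \<longleftrightarrow> (AE t in \<mu>. x t = 0)"
    and scale_mem: "x \<in> carr E \<Longrightarrow> (\<lambda>t. a * x t) \<in> carr E"
    and nrm_scale: "x \<in> carr E \<Longrightarrow> nrm E (\<lambda>t. a * x t) = \<bar>a\<bar> * nrm E x"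
    and ideal_mem: "y \<in> carr E \<Longrightarrow> x \<in> borel_measurable \<mu> \<Longrightarrow>
       (AE t in \<mu>. \<bar>x t\<bar> \<le> \<bar>y t\<bar>) \<Longrightarrow> x \<in> carr E"
    and nrm_mono: "y \<in> carr E \<Longrightarrow> x \<in> borel_measurable \<mu> \<Longrightarrow>
       (AE t in \<mu>. \<bar>x t\<bar> \<le> \<bar>y t\<bar>) \<Longrightarrow> nrm E x \<le> nrm E y"
    and dominated: "(\<And>n. Y n \<in> carr E) \<Longrightarrow> (\<And>n. nrm E (Y n) \<le> 1) \<Longrightarrow>
       \<exists>y\<in>carr E. \<forall>n. AE t in \<mu>. \<bar>Y n t\<bar> \<le> 4 ^ n * \<bar>y t\<bar>"

text \<open>By completeness the series of the functions 2^-k |Y k| converges in norm to some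
  \<open>s\<close>. Its partial sums increase, so their norm limit dominates each of them
  a.e.\<close>

lemma banach_ideal_dominated:
  fixes Y :: "nat \<Rightarrow> 'a \<Rightarrow> real"
  assumes E: "banach_ideal_space \<mu> E"
    and Y: "\<And>n. Y n \<in> carr E" "\<And>n. nrm E (Y n) \<le> 1"
  shows "\<exists>s\<in>carr E. \<forall>n. AE t in \<mu>. \<bar>Y n t\<bar> \<le> 2 ^ n * \<bar>s t\<bar>"
proof -
  have meas: "x \<in> borel_measurable \<mu>" if "x \<in> carr E" for x
    using E that unfolding banach_ideal_space_def by blast
  have add: "(\<lambda>t. x t + y t) \<in> carr E" "nrm E (\<lambda>t. x t + y t) \<le> nrm E x + nrm E y"
    if "x \<in> carr E" "y \<in> carr E" for x y
    using E that unfolding banach_ideal_space_def by blast+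
  have scale: "(\<lambda>t. a * x t) \<in> carr E" "nrm E (\<lambda>t. a * x t) = \<bar>a\<bar> * nrm E x"
    if "x \<in> carr E" for a x
    using E that unfolding banach_ideal_space_def by blast+
  have ideal: "x \<in> carr E" "nrm E x \<le> nrm E y"
    if "y \<in> carr E" "x \<in> borel_measurable \<mu>" "AE t in \<mu>. \<bar>x t\<bar> \<le> \<bar>y t\<bar>" for x y
    using E that unfolding banach_ideal_space_def by blast+
  have zero: "(\<lambda>t. 0) \<in> carr E" using E unfolding banach_ideal_space_def by blast
  have nrm_zero_iff: "nrm E x = 0 \<longleftrightarrow> (AE t in \<mu>. x t = 0)" if "x \<in> carr E" for x
    using E that unfolding banach_ideal_space_def by blast
  have nonneg: "0 \<le> nrm E x" if "x \<in> carr E" for x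
    using E that unfolding banach_ideal_space_def by blast
  have nrm0: "nrm E (\<lambda>t. 0) = 0" using nrm_zero_iff[OF zero] by simp
  define Z where "Z k = (\<lambda>t. (1/2) ^ k * \<bar>Y k t\<bar>)" for k
  have absY: "(\<lambda>t. \<bar>Y k t\<bar>) \<in> carr E" "nrm E (\<lambda>t. \<bar>Y k t\<bar>) \<le> nrm E (Y k)" for k
    using ideal[OF Y(1)[of k], of "\<lambda>t. \<bar>Y k t\<bar>"] meas[OF Y(1)[of k]] by auto
  have Z: "Z k \<in> carr E" "nrm E (Z k) \<le> (1/2) ^ k" for k
    using scale[OF absY(1)[of k], of "(1/2)^k"] absY(2)[of k] Y(2)[of k]
    unfolding Z_def by (auto intro: mult_left_le order_trans)
  define S where "S n = (\<lambda>t. \<Sum>k<n. Z k t)" for n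
  have sum_mem: "(\<lambda>t. \<Sum>k\<in>K. Z k t) \<in> carr E \<and> nrm E (\<lambda>t. \<Sum>k\<in>K. Z k t) \<le> (\<Sum>k\<in>K. (1/2)^k)"
    if "finite K" for K
    using that
  proof (induction K rule: finite_induct)
    case empty
    then show ?case using zero nrm0 by simp
  next
    case (insert k K)
    then show ?case using add[OF Z(1)[of k], of "\<lambda>t. \<Sum>k\<in>K. Z k t"] Z(2)[of k] by simp
  qed
  have Sm: "S n \<in> carr E" for n using sum_mem[of "{..<n}"] by (simp add: S_def)
  have diff_mem: "(\<lambda>t. x t - y t) \<in> carr E" if "x \<in> carr E" "y \<in> carr E" for x y
    using add(1)[OF that(1) scale(1)[OF that(2), of "-1"]] by simp
  have diff_sym: "nrm E (\<lambda>t. x t - y t) = nrm E (\<lambda>t. y t - x t)"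
    if "x \<in> carr E" "y \<in> carr E" for x y
    using scale(2)[OF diff_mem[OF that(2,1)], of "-1"] by simp
  have le: "nrm E (\<lambda>t. S m t - S n t) \<le> 2 * (1/2)^n" if "n \<le> m" for m n
  proof -
    have *: "(\<lambda>t. S m t - S n t) = (\<lambda>t. \<Sum>k\<in>{n..<m}. Z k t)"
      using that unfolding S_def by (auto simp: sum_diff_nat_ivl lessThan_atLeast0)
    have "nrm E (\<lambda>t. S m t - S n t) \<le> (\<Sum>k\<in>{n..<m}. (1/2)^k)"
      unfolding * using sum_mem by blast
    also have "\<dots> = 2 * (1/2)^n - 2 * (1/2)^m"
      using that by (induction rule: dec_induct) auto
    also have "\<dots> \<le> 2 * (1/2)^n" by simp
    finally show ?thesis .
  qed
  have complete: "\<forall>X. (\<forall>n. X n \<in> carr E) \<and>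
          (\<forall>e>0. \<exists>N::nat. \<forall>m\<ge>N. \<forall>n\<ge>N. nrm E (\<lambda>t. X m t - X n t) < e) \<longrightarrow>
          (\<exists>x\<in>carr E. (\<lambda>n. nrm E (\<lambda>t. X n t - x t)) \<longlonglongrightarrow> 0)"
    using E unfolding banach_ideal_space_def by (elim conjE)
  have "\<exists>N. \<forall>m\<ge>N. \<forall>n\<ge>N. nrm E (\<lambda>t. S m t - S n t) < e" if e: "e > 0" for e
  proof -
    obtain N where N: "(1/2::real)^N < e/2"
      using real_arch_pow_inv[OF half_gt_zero[OF e], of "1/2"] by force
    have "nrm E (\<lambda>t. S m t - S n t) < e" if "m \<ge> N" "n \<ge> N" for m n
    proof -
      have "nrm E (\<lambda>t. S m t - S n t) \<le> 2 * (1/2)^(min m n)"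
        using le[of n m] le[of m n] diff_sym[OF Sm[of m] Sm[of n]] by (cases "n \<le> m") (auto simp: min_def)
      also have "\<dots> \<le> 2 * (1/2)^N" using that by (intro mult_left_mono power_decreasing) auto
      finally show ?thesis using N by simp
    qed
    then show ?thesis by blast
  qed
  then obtain s where s: "s \<in> carr E" "(\<lambda>n. nrm E (\<lambda>t. S n t - s t)) \<longlonglongrightarrow> 0"
    using complete[rule_format, of S] Sm by blast
  have S_le: "AE t in \<mu>. S n t \<le> s t" for n
  proof -
    \<comment> \<open>The positive part of \<open>S n - s\<close> lies below |S m - s| for every m
      \<ge> n, because the partial sums increase. Its norm is therefore 0.\<close>
    define r where "r = (\<lambda>t. max 0 (S n t - s t))"
    have rm: "r \<in> borel_measurable \<mu>"
      unfolding r_def using meas[OF Sm[of n]] meas[OF s(1)] by measurable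
    have "nrm E r \<le> nrm E (\<lambda>t. S m t - s t)" "r \<in> carr E" if "n \<le> m" for m
    proof -
      have "S n t \<le> S m t" for t unfolding S_def Z_def
        using that by (intro sum_mono2) auto
      then have "AE t in \<mu>. \<bar>r t\<bar> \<le> \<bar>S m t - s t\<bar>"
        unfolding r_def by (intro AE_I2) (smt (verit))
      then show "nrm E r \<le> nrm E (\<lambda>t. S m t - s t)" "r \<in> carr E"
        using ideal[OF diff_mem[OF Sm s(1)] rm] by blast+
    qed
    moreover from this have "nrm E r \<le> 0"
      by (intro tendsto_lowerbound[OF s(2)]) (auto intro!: eventually_sequentiallyI[of n])
    ultimately have "AE t in \<mu>. r t = 0" using nonneg nrm_zero_iff[of r] by (metis order.antisym order.refl)
    then show ?thesis unfolding r_def by eventually_elim linarith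
  qed
  have "AE t in \<mu>. \<bar>Y n t\<bar> \<le> 2 ^ n * \<bar>s t\<bar>" for n
    using S_le[of "Suc n"]
  proof eventually_elim
    case (elim t)
    have "Z n t \<le> S (Suc n) t" unfolding S_def Z_def by (simp add: sum_nonneg)
    with elim have "(1/2)^n * \<bar>Y n t\<bar> \<le> \<bar>s t\<bar>" unfolding Z_def by linarith
    then show ?case by (simp add: field_simps power_divide)
  qed
  with s(1) show ?thesis by blast
qed

text \<open>The factor 2^n is weakened to 4^n so that the same property holds for Cesaro spaces; see
  \<open>ces_dominated\<close>, where one factor 2^n is spent on convergence.\<close>

lemma banach_ideal_imp_ideal_fspace:
  assumes E: "banach_ideal_space \<mu> E"
  shows "ideal_fspace \<mu> E"
proof
  fix Y :: "nat \<Rightarrow> 'a \<Rightarrow> real"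
  assume "\<And>n. Y n \<in> carr E" "\<And>n. nrm E (Y n) \<le> 1"
  then obtain s where s: "s \<in> carr E" "\<And>n. AE t in \<mu>. \<bar>Y n t\<bar> \<le> 2 ^ n * \<bar>s t\<bar>"
    using banach_ideal_dominated[OF E] by blast
  have "AE t in \<mu>. \<bar>Y n t\<bar> \<le> 4 ^ n * \<bar>s t\<bar>" for n
    using s(2)[of n]
  proof eventually_elim
    case (elim t)
    have "(2::real)^n * \<bar>s t\<bar> \<le> 4 ^ n * \<bar>s t\<bar>" by (intro mult_right_mono power_mono) auto
    with elim show ?case by linarith
  qed
  then show "\<exists>y\<in>carr E. \<forall>n. AE t in \<mu>. \<bar>Y n t\<bar> \<le> 4 ^ n * \<bar>y t\<bar>" using s(1) by blast
qed (use E in \<open>(unfold banach_ideal_space_def, blast)+\<close>)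

context ideal_fspace
begin

lemma cong_mem:
  assumes "y \<in> carr E" "x \<in> borel_measurable \<mu>" "AE t in \<mu>. \<bar>x t\<bar> = \<bar>y t\<bar>"
  shows "x \<in> carr E" "nrm E x = nrm E y"
proof -
  have le: "AE t in \<mu>. \<bar>x t\<bar> \<le> \<bar>y t\<bar>" "AE t in \<mu>. \<bar>y t\<bar> \<le> \<bar>x t\<bar>"
    using assms(3) by (eventually_elim, simp)+
  show x: "x \<in> carr E" by (rule ideal_mem[OF assms(1,2) le(1)])
  show "nrm E x = nrm E y"
    using nrm_mono[OF assms(1,2) le(1)] nrm_mono[OF x meas[OF assms(1)] le(2)] by simp
qed

lemma abs_mem: "x \<in> carr E \<Longrightarrow> (\<lambda>t. \<bar>x t\<bar>) \<in> carr E" "x \<in> carr E \<Longrightarrow> nrm E (\<lambda>t. \<bar>x t\<bar>) = nrm E x"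
  using cong_mem[of x "\<lambda>t. \<bar>x t\<bar>"] meas[of x] by auto

lemma scaled_mem:
  assumes "y \<in> carr E" "x \<in> borel_measurable \<mu>" "AE t in \<mu>. \<bar>x t\<bar> \<le> c * \<bar>y t\<bar>" "0 \<le> c"
  shows "x \<in> carr E" "nrm E x \<le> c * nrm E y"
proof -
  have "AE t in \<mu>. \<bar>x t\<bar> \<le> \<bar>c * y t\<bar>" using assms(3,4) by (simp add: abs_mult)
  from ideal_mem[OF scale_mem[OF assms(1)] assms(2) this] nrm_mono[OF scale_mem[OF assms(1)] assms(2) this]
  show "x \<in> carr E" "nrm E x \<le> c * nrm E y" using nrm_scale[OF assms(1), of c] assms(4) by auto
qed

end

text \<open>
  A gliding hump replaces the closed graph theorem; it needs of \<open>E\<close> only the domination property,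
  which for Cesaro spaces is easier to get than completeness.
\<close>

lemma multiplier_bdd_above:
  assumes E: "ideal_fspace \<mu> E" and F: "ideal_fspace \<mu> F" and w: "w \<in> carr (multipliers \<mu> E F)"
  shows "bdd_above {nrm F (\<lambda>t. w t * y t) | y. y \<in> carr E \<and> nrm E y = 1}"
proof (rule ccontr)
  interpret E: ideal_fspace \<mu> E by fact
  interpret F: ideal_fspace \<mu> F by fact
  have wy: "(\<lambda>t. w t * y t) \<in> carr F" if "y \<in> carr E" for y
    using w that by (auto simp: multipliers_def)
  assume unbounded: "\<not> ?thesis"
  \<comment> \<open>The growth 8^n beats the domination factor 4^n and leaves 2^n, which no fixed
    norm can exceed for all \<open>n\<close>.\<close>
  have "\<exists>y. y \<in> carr E \<and> nrm E y = 1 \<and> 8 ^ n < nrm F (\<lambda>t. w t * y t)" for n :: nat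
  proof (rule ccontr)
    assume "\<not> ?thesis"
    then have "bdd_above {nrm F (\<lambda>t. w t * y t) | y. y \<in> carr E \<and> nrm E y = 1}"
      by (intro bdd_aboveI[of _ "8 ^ n"]) force
    with unbounded show False ..
  qed
  then obtain Y where Y: "\<And>n. Y n \<in> carr E" "\<And>n. nrm E (Y n) = 1"
      "\<And>n::nat. 8 ^ n < nrm F (\<lambda>t. w t * Y n t)" by metis
  obtain y where y: "y \<in> carr E" "\<And>n. AE t in \<mu>. \<bar>Y n t\<bar> \<le> 4 ^ n * \<bar>y t\<bar>"
    using E.dominated[of Y] Y by auto
  have "2 ^ n < nrm F (\<lambda>t. w t * y t)" for n :: nat
  proof -
    have "AE t in \<mu>. \<bar>w t * Y n t\<bar> \<le> 4 ^ n * \<bar>w t * y t\<bar>"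
      using y(2)[of n]
    proof eventually_elim
      case (elim t)
      from mult_left_mono[OF this abs_ge_zero[of "w t"]] show ?case by (simp add: abs_mult ac_simps)
    qed
    from F.scaled_mem(2)[OF wy[OF y(1)] F.meas[OF wy[OF Y(1)]] this]
    have "8 ^ n < 4 ^ n * nrm F (\<lambda>t. w t * y t)" using Y(3)[of n] by simp
    moreover have "(8::real) ^ n = 4 ^ n * 2 ^ n" by (simp flip: power_mult_distrib)
    ultimately show ?thesis by simp
  qed
  moreover obtain n :: nat where "nrm F (\<lambda>t. w t * y t) < 2 ^ n"
    using real_arch_pow[of 2] by auto
  ultimately show False using less_asym by blast
qed

lemma multiplier_bound:
  assumes E: "ideal_fspace \<mu> E" and F: "ideal_fspace \<mu> F"
    and w: "w \<in> carr (multipliers \<mu> E F)" and y: "y \<in> carr E"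
  shows "nrm F (\<lambda>t. w t * y t) \<le> nrm (multipliers \<mu> E F) w * nrm E y"
proof -
  interpret E: ideal_fspace \<mu> E by fact
  interpret F: ideal_fspace \<mu> F by fact
  have wy: "(\<lambda>t. w t * y t) \<in> carr F" if "y \<in> carr E" for y
    using w that by (auto simp: multipliers_def)
  show ?thesis
  proof (cases "nrm E y = 0")
    case True
    then have "AE t in \<mu>. y t = 0" using E.nrm_zero_iff y by blast
    then have "AE t in \<mu>. w t * y t = 0" by eventually_elim simp
    then show ?thesis using F.nrm_zero_iff[OF wy[OF y]] True by simp
  next
    case False
    then have pos: "nrm E y > 0" using E.nrm_nonneg[OF y] by simp
    define z where "z = (\<lambda>t. (1 / nrm E y) * y t)"
    have z: "z \<in> carr E" "nrm E z = 1"
      unfolding z_def using E.scale_mem[OF y, of "1 / nrm E y"] E.nrm_scale[OF y, of "1 / nrm E y"] pos by auto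
    have "nrm F (\<lambda>t. w t * z t) \<le> nrm (multipliers \<mu> E F) w"
      using z multiplier_bdd_above[OF E F w] by (auto simp: multipliers_def intro!: cSup_upper)
    moreover have "(\<lambda>t. w t * z t) = (\<lambda>t. (1 / nrm E y) * (w t * y t))" by (auto simp: z_def)
    ultimately have "1 / nrm E y * nrm F (\<lambda>t. w t * y t) \<le> nrm (multipliers \<mu> E F) w"
      using F.nrm_scale[OF wy[OF y], of "1 / nrm E y"] pos by simp
    then show ?thesis using pos by (simp add: pos_divide_le_eq)
  qed
qed

text \<open>A real \<open>Sup\<close> over an empty set has no known sign. Given an element of
  nonzero norm, the sign is read off from \<open>multiplier_bound\<close> by dividing by that
  norm.\<close>

lemma multipliers_nrm_nonneg:
  assumes E: "ideal_fspace \<mu> E" and F: "ideal_fspace \<mu> F"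
    and w: "w \<in> carr (multipliers \<mu> E F)" and y: "y \<in> carr E" "nrm E y \<noteq> 0"
  shows "0 \<le> nrm (multipliers \<mu> E F) w"
proof -
  have "(\<lambda>t. w t * y t) \<in> carr F" using w y by (auto simp: multipliers_def)
  then have "0 \<le> nrm (multipliers \<mu> E F) w * nrm E y"
    using multiplier_bound[OF E F w y(1)] ideal_fspace.nrm_nonneg[OF F] order_trans by blast
  then show ?thesis using y ideal_fspace.nrm_nonneg[OF E y(1)] by (simp add: zero_le_mult_iff)
qed

lemma multipliers_nrm_le:
  assumes E: "ideal_fspace \<mu> E" and e: "e \<in> carr E" "nrm E e \<noteq> 0"
    and K: "\<And>y. y \<in> carr E \<Longrightarrow> nrm F (\<lambda>t. w t * y t) \<le> K * nrm E y"
  shows "nrm (multipliers \<mu> E F) w \<le> K"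
proof -
  interpret E: ideal_fspace \<mu> E by fact
  have "(\<lambda>t. (1 / nrm E e) * e t) \<in> carr E" "nrm E (\<lambda>t. (1 / nrm E e) * e t) = 1"
    using E.scale_mem[OF e(1), of "1 / nrm E e"] E.nrm_scale[OF e(1), of "1 / nrm E e"] e(2) E.nrm_nonneg[OF e(1)] by auto
  then have "{nrm F (\<lambda>t. w t * y t) | y. y \<in> carr E \<and> nrm E y = 1} \<noteq> {}" by blast
  then show ?thesis unfolding multipliers_def using K by (auto intro!: cSup_least) fastforce
qed

text \<open>This reduces the equality of spaces to one quantitative factorization of each
  \<open>f\<close> of nonzero norm. A bound \<open>K\<close> for multiplication by \<open>w\<close>
  replaces the multiplier norm of \<open>w\<close>. Functions of norm 0 factor as 0 times 0.\<close>

lemma factorization_criterion: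
  assumes A: "ideal_fspace \<mu> A" and B: "ideal_fspace \<mu> B"
    and e: "e \<in> carr A" "nrm A e \<noteq> 0" and zeroA: "(\<lambda>t. 0) \<in> carr A" and zeroB: "(\<lambda>t. 0) \<in> carr B"
    and fac: "\<And>f. f \<in> carr B \<Longrightarrow> nrm B f \<noteq> 0 \<Longrightarrow> \<exists>x\<in>carr A. \<exists>w\<in>borel_measurable \<mu>. \<exists>K\<ge>0.
        (AE t in \<mu>. f t = x t * w t) \<and> nrm A x * K \<le> C * nrm B f \<and>
        (\<forall>y\<in>carr A. (\<lambda>t. w t * y t) \<in> carr B \<and> nrm B (\<lambda>t. w t * y t) \<le> K * nrm A y)"
  shows "same_space B (product_space \<mu> A (multipliers \<mu> A B))"
proof -
  interpret A: ideal_fspace \<mu> A by fact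
  interpret B: ideal_fspace \<mu> B by fact
  let ?M = "multipliers \<mu> A B"
  let ?P = "product_space \<mu> A ?M"
  let ?N = "\<lambda>f. {nrm A x * nrm ?M w | x w. x \<in> carr A \<and> w \<in> carr ?M \<and> (AE t in \<mu>. f t = x t * w t)}"
  \<comment> \<open>\<open>same_space\<close> asks for a positive constant, and the sign of
    \<open>C\<close> is not known.\<close>
  define C' where "C' = max C 1"
  have lower: "f \<in> carr B \<and> nrm B f \<le> nrm A x * nrm ?M w"
    if "f \<in> borel_measurable \<mu>" "x \<in> carr A" "w \<in> carr ?M" "AE t in \<mu>. f t = x t * w t" for f x w
  proof -
    have "(\<lambda>t. w t * x t) \<in> carr B" using that by (auto simp: multipliers_def)
    moreover have "AE t in \<mu>. \<bar>f t\<bar> = \<bar>w t * x t\<bar>" using that(4) by eventually_elim (simp add: mult.commute)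
    ultimately show ?thesis
      using B.cong_mem[of "\<lambda>t. w t * x t" f] that(1) multiplier_bound[OF A B that(3,2)]
      by (auto simp: mult.commute)
  qed
  have upper: "\<exists>x w. x \<in> carr A \<and> w \<in> carr ?M \<and> (AE t in \<mu>. f t = x t * w t) \<and>
      nrm A x * nrm ?M w \<le> C' * nrm B f" if f: "f \<in> carr B" for f
  proof (cases "nrm B f = 0")
    case True
    then have "AE t in \<mu>. f t = 0" using B.nrm_zero_iff f by blast
    moreover have "(\<lambda>t. 0) \<in> carr ?M" using zeroB by (auto simp: multipliers_def)
    moreover have "nrm A (\<lambda>t. 0) = 0" using A.nrm_zero_iff[OF zeroA] by simp
    ultimately show ?thesis using zeroA True by (intro exI[of _ "\<lambda>t. 0"]) auto
  next
    case False
    then obtain x w K where xw: "x \<in> carr A" "w \<in> borel_measurable \<mu>" "K \<ge> 0" "AE t in \<mu>. f t = x t * w t"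
        "nrm A x * K \<le> C * nrm B f"
        "\<And>y. y \<in> carr A \<Longrightarrow> (\<lambda>t. w t * y t) \<in> carr B"
        "\<And>y. y \<in> carr A \<Longrightarrow> nrm B (\<lambda>t. w t * y t) \<le> K * nrm A y"
      using fac[OF f] by blast
    have "w \<in> carr ?M" using xw by (auto simp: multipliers_def)
    moreover have "nrm ?M w \<le> K" by (rule multipliers_nrm_le[OF A e xw(7)])
    then have "nrm A x * nrm ?M w \<le> nrm A x * K" using A.nrm_nonneg[OF xw(1)] by (rule mult_left_mono)
    moreover have "C * nrm B f \<le> C' * nrm B f"
      unfolding C'_def using B.nrm_nonneg[OF f] by (intro mult_right_mono) auto
    ultimately show ?thesis using xw by (intro exI[of _ x] exI[of _ w]) auto
  qed
  have P: "f \<in> carr ?P \<longleftrightarrow> f \<in> borel_measurable \<mu> \<and>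
      (\<exists>x\<in>carr A. \<exists>w\<in>carr ?M. AE t in \<mu>. f t = x t * w t)" for f
    by (simp add: product_space_def)
  have "carr B = carr ?P"
  proof (intro set_eqI iffI)
    fix f assume "f \<in> carr B"
    with upper[of f] B.meas[of f] show "f \<in> carr ?P" unfolding P by blast
  next
    fix f assume "f \<in> carr ?P"
    then show "f \<in> carr B" unfolding P using lower by blast
  qed
  moreover have "1 * nrm B f \<le> nrm ?P f \<and> nrm ?P f \<le> C' * nrm B f" if f: "f \<in> carr B" for f
  proof -
    obtain x w where xw: "x \<in> carr A" "w \<in> carr ?M" "AE t in \<mu>. f t = x t * w t"
      "nrm A x * nrm ?M w \<le> C' * nrm B f" using upper[OF f] by blast
    have bd: "nrm B f \<le> z" if "z \<in> ?N f" for z using that lower B.meas[OF f] by blast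
    have "nrm B f \<le> Inf (?N f)" by (intro cInf_greatest) (use xw bd in blast)+
    moreover have "Inf (?N f) \<le> nrm A x * nrm ?M w"
      by (intro cInf_lower) (use xw bd in \<open>auto simp: bdd_below_def\<close>)
    ultimately show ?thesis using xw(4) by (simp add: product_space_def)
  qed
  moreover have "C' > 0" by (simp add: C'_def)
  ultimately show ?thesis unfolding same_space_def by (metis zero_less_one)
qed

subsection \<open>Hardy operators over a linearly ordered measure space\<close>

definition init_seg :: "'a::linorder measure \<Rightarrow> 'a \<Rightarrow> 'a set" where
  "init_seg \<mu> t = {s \<in> space \<mu>. s \<le> t}"

text \<open>The sets \<open>S\<close> are a parameter, so the same heights can sit on initial
  segments or on another chain of sets. A maximum, rather than a sum of increments, makes every
  level set a plain union of sets \<open>S g\<close>; the inserted 0 covers points outside all of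
  them.\<close>

definition step_fun :: "('a \<Rightarrow> 'a set) \<Rightarrow> 'a set \<Rightarrow> ('a \<Rightarrow> real) \<Rightarrow> 'a \<Rightarrow> real" where
  "step_fun S G z t = Max (insert 0 ((\<lambda>g. z g * indicator (S g) t) ` G))"

lemma step_fun_nonneg: "finite G \<Longrightarrow> 0 \<le> step_fun S G z t"
  unfolding step_fun_def by simp

lemma step_fun_upper: "finite G \<Longrightarrow> g \<in> G \<Longrightarrow> t \<in> S g \<Longrightarrow> z g \<le> step_fun S G z t"
  unfolding step_fun_def by (auto intro!: Max_ge image_eqI[of _ _ g])

lemma step_fun_least:
  assumes "finite G" "0 \<le> c" "\<And>g. g \<in> G \<Longrightarrow> t \<in> S g \<Longrightarrow> z g \<le> c"
  shows "step_fun S G z t \<le> c"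
  unfolding step_fun_def using assms by (auto simp: indicator_def)

lemma step_fun_greater_iff:
  assumes "finite G" "0 \<le> l"
  shows "l < step_fun S G z t \<longleftrightarrow> (\<exists>g\<in>G. t \<in> S g \<and> l < z g)"
  unfolding step_fun_def using assms by (auto simp: Max_gr_iff indicator_def split: if_splits)

lemma step_fun_measurable:
  assumes "finite G" "\<And>g. g \<in> G \<Longrightarrow> S g \<in> sets \<mu>"
  shows "step_fun S G z \<in> borel_measurable \<mu>"
proof (cases "G = {}")
  case True
  then show ?thesis by (simp add: step_fun_def[abs_def])
next
  case False
  have "(\<lambda>t. max 0 (Max ((\<lambda>g. z g * indicator (S g) t) ` G))) \<in> borel_measurable \<mu>"
    using assms by (intro borel_measurable_max borel_measurable_Max borel_measurable_times
        borel_measurable_indicator borel_measurable_const) auto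
  then show ?thesis using False assms(1) by (simp add: step_fun_def[abs_def])
qed

text \<open>
  Common abstraction of the half-line and the positive integers. \<open>Hd\<close> says that \<open>H\<close> is defined,
  \<open>half\<close> is \<open>t/2\<close>, rounded up for integers (which makes the axiom \<open>less_half\<close> true there), and \<open>D\<close>
  is a countable set from which decreasing functions are approximated by step functions.
\<close>

locale hardy_structure =
  fixes \<mu> :: "'a::linorder measure" and H :: "('a \<Rightarrow> real) \<Rightarrow> 'a \<Rightarrow> real"
    and Hd :: "('a \<Rightarrow> real) \<Rightarrow> bool" and half :: "'a \<Rightarrow> 'a" and D :: "'a set"
  assumes downset_sets: "U \<subseteq> space \<mu> \<Longrightarrow> (\<And>s t. t \<in> U \<Longrightarrow> s \<in> space \<mu> \<Longrightarrow> s \<le> t \<Longrightarrow> s \<in> U) \<Longrightarrow> U \<in> sets \<mu>"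
    and init_seg_pos: "t \<in> space \<mu> \<Longrightarrow> 0 < emeasure \<mu> (init_seg \<mu> t)"
    and init_seg_fin: "t \<in> space \<mu> \<Longrightarrow> emeasure \<mu> (init_seg \<mu> t) < \<infinity>"
    and double: "t \<in> space \<mu> \<Longrightarrow>
      \<exists>t'\<in>space \<mu>. measure \<mu> (init_seg \<mu> t') = 2 * measure \<mu> (init_seg \<mu> t)"
    and half_space: "t \<in> space \<mu> \<Longrightarrow> half t \<in> space \<mu>"
    and half_le: "t \<in> space \<mu> \<Longrightarrow> half t \<le> t"
    and half_mono: "s \<in> space \<mu> \<Longrightarrow> t \<in> space \<mu> \<Longrightarrow> s \<le> t \<Longrightarrow> half s \<le> half t"
    and half_measure: "t \<in> space \<mu> \<Longrightarrow>
      measure \<mu> (init_seg \<mu> t) \<le> 2 * measure \<mu> (init_seg \<mu> (half t))"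
    and less_half: "t \<in> space \<mu> \<Longrightarrow> A \<in> sets \<mu> \<Longrightarrow> emeasure \<mu> A < emeasure \<mu> (init_seg \<mu> (half t)) \<Longrightarrow>
      2 * emeasure \<mu> A \<le> emeasure \<mu> (init_seg \<mu> t)"
    and intermediate: "t \<in> space \<mu> \<Longrightarrow> S \<in> sets \<mu> \<Longrightarrow> A \<in> sets \<mu> \<Longrightarrow> S \<subseteq> A \<Longrightarrow>
      emeasure \<mu> S \<le> emeasure \<mu> (init_seg \<mu> t) \<Longrightarrow> emeasure \<mu> (init_seg \<mu> t) \<le> emeasure \<mu> A \<Longrightarrow>
      \<exists>B\<in>sets \<mu>. S \<subseteq> B \<and> B \<subseteq> A \<and> emeasure \<mu> B = emeasure \<mu> (init_seg \<mu> t)"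
    and D: "countable D" "D \<subseteq> space \<mu>" "D \<noteq> {}"
    and D_dense: "(\<And>s t. s \<in> space \<mu> \<Longrightarrow> t \<in> space \<mu> \<Longrightarrow> s \<le> t \<Longrightarrow> (z t :: real) \<le> z s) \<Longrightarrow>
      AE t in \<mu>. \<forall>e>0. \<exists>g\<in>D. t \<le> g \<and> z t - e < z g"
    and H_nonneg: "x \<in> borel_measurable \<mu> \<Longrightarrow> (\<And>s. 0 \<le> x s) \<Longrightarrow> Hd x \<Longrightarrow> t \<in> space \<mu> \<Longrightarrow> 0 \<le> H x t"
    and H_eq: "x \<in> borel_measurable \<mu> \<Longrightarrow> (\<And>s. 0 \<le> x s) \<Longrightarrow> Hd x \<Longrightarrow> t \<in> space \<mu> \<Longrightarrow>
      (\<integral>\<^sup>+s\<in>init_seg \<mu> t. ennreal (x s) \<partial>\<mu>) = ennreal (H x t * measure \<mu> (init_seg \<mu> t))"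
    and Hd_iff: "x \<in> borel_measurable \<mu> \<Longrightarrow> (\<And>s. 0 \<le> x s) \<Longrightarrow>
      Hd x \<longleftrightarrow> (\<forall>t\<in>space \<mu>. (\<integral>\<^sup>+s\<in>init_seg \<mu> t. ennreal (x s) \<partial>\<mu>) < \<infinity>)"
begin

abbreviation "J \<equiv> init_seg \<mu>"
abbreviation "m t \<equiv> measure \<mu> (init_seg \<mu> t)"

text \<open>Nonnegativity is demanded outside \<open>space \<mu>\<close> too, to match the side
  conditions of \<open>H_eq\<close> and \<open>Hd_iff\<close>. This is why functions constructed
  below by a supremum are set to 0 there.\<close>

definition decreasing :: "('a \<Rightarrow> real) \<Rightarrow> bool" where
  "decreasing z \<longleftrightarrow> (\<forall>t. 0 \<le> z t) \<and> (\<forall>s\<in>space \<mu>. \<forall>t\<in>space \<mu>. s \<le> t \<longrightarrow> z t \<le> z s)"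

lemma decreasing_nonneg: "decreasing z \<Longrightarrow> 0 \<le> z t"
  and decreasingD: "decreasing z \<Longrightarrow> s \<in> space \<mu> \<Longrightarrow> t \<in> space \<mu> \<Longrightarrow> s \<le> t \<Longrightarrow> z t \<le> z s"
  by (auto simp: decreasing_def)

lemma decreasing_mult: "decreasing w \<Longrightarrow> decreasing y \<Longrightarrow> decreasing (\<lambda>t. w t * y t)"
  by (auto simp: decreasing_def intro!: mult_mono)

lemma J_sets [measurable]: "J t \<in> sets \<mu>"
  by (rule downset_sets) (auto simp: init_seg_def)

lemma J_mono: "s \<le> t \<Longrightarrow> J s \<subseteq> J t"
  by (auto simp: init_seg_def)

lemma emeasure_J: "t \<in> space \<mu> \<Longrightarrow> emeasure \<mu> (J t) = ennreal (m t)"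
  using init_seg_fin by (simp add: emeasure_eq_ennreal_measure less_top[symmetric])

lemma m_pos: "t \<in> space \<mu> \<Longrightarrow> 0 < m t"
  using init_seg_pos[of t] emeasure_J[of t] by (simp add: ennreal_less_zero_iff)

lemma m_mono: "s \<in> space \<mu> \<Longrightarrow> t \<in> space \<mu> \<Longrightarrow> s \<le> t \<Longrightarrow> m s \<le> m t"
  using emeasure_mono[OF J_mono J_sets, of s t] emeasure_J[of t] emeasure_J[of s] by simp

lemma monotone_measurable:
  assumes "\<And>s t. s \<in> space \<mu> \<Longrightarrow> t \<in> space \<mu> \<Longrightarrow> s \<le> t \<Longrightarrow> (z s :: real) \<le> z t"
  shows "z \<in> borel_measurable \<mu>"
proof (rule borel_measurableI_less)
  fix c :: real
  show "{t \<in> space \<mu>. z t < c} \<in> sets \<mu>"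
  proof (rule downset_sets)
    fix s t assume "t \<in> {t \<in> space \<mu>. z t < c}" "s \<in> space \<mu>" "s \<le> t"
    then show "s \<in> {t \<in> space \<mu>. z t < c}" using assms[of s t] by auto
  qed auto
qed

lemma decreasing_measurable: "decreasing z \<Longrightarrow> z \<in> borel_measurable \<mu>"
  using monotone_measurable[of "\<lambda>t. - z t"] borel_measurable_uminus_eq[of z \<mu>]
  by (auto simp: decreasing_def)

text \<open>The block \<open>J t' - J t\<close> is a copy of \<open>J t\<close> to the right of
  \<open>t\<close>. Averages of a nonnegative function lose at most a factor 2 there
  (\<open>H_double\<close>), which turns one value of \<open>H x\<close> into a lower bound on a set
  of known measure.\<close>

lemma less_space:
  assumes "t \<in> space \<mu>"
  shows "\<exists>t'\<in>space \<mu>. t < t' \<and> m t' = 2 * m t \<and> emeasure \<mu> (J t' - J t) = emeasure \<mu> (J t)"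
proof -
  obtain t' where t': "t' \<in> space \<mu>" "m t' = 2 * m t" using double assms by blast
  have "t < t'"
    using m_mono[OF t'(1) assms] t'(2) m_pos[OF assms] by (cases "t' \<le> t") auto
  moreover have "emeasure \<mu> (J t' - J t) = emeasure \<mu> (J t)"
    using emeasure_Diff[of \<mu> "J t" "J t'"] J_mono[of t t'] \<open>t < t'\<close> emeasure_J[OF assms] emeasure_J[OF t'(1)] t'(2)
    by (simp add: ennreal_minus)
  ultimately show ?thesis using t' by blast
qed

section \<open>Step functions on chains of sets\<close>

lemma step_fun_le:
  assumes "finite G" "G \<subseteq> space \<mu>" "decreasing z" "t \<in> space \<mu>"
  shows "step_fun J G z t \<le> z t"
  using assms by (intro step_fun_least) (auto simp: init_seg_def decreasing_nonneg intro: decreasingD)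

text \<open>In a chain, the level set at \<open>l\<close> is \<open>S b\<close>, where
  \<open>b\<close> is the last point of \<open>G\<close> with l < z b; on the other side it is
  \<open>J b\<close>, of the same measure.\<close>

lemma equimeasurable_step_fun:
  assumes G: "finite G" "G \<subseteq> space \<mu>" and z: "decreasing z"
    and chain: "\<And>g g'. g \<in> G \<Longrightarrow> g' \<in> G \<Longrightarrow> g \<le> g' \<Longrightarrow> S g \<subseteq> S g'"
    and S: "\<And>g. g \<in> G \<Longrightarrow> S g \<in> sets \<mu>" "\<And>g. g \<in> G \<Longrightarrow> emeasure \<mu> (S g) = emeasure \<mu> (J g)"
  shows "equimeasurable \<mu> (step_fun S G z) (step_fun J G z)"
  unfolding equimeasurable_def
proof (intro allI impI)
  fix l :: real assume l: "0 \<le> l"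
  have level: "{t \<in> space \<mu>. \<bar>step_fun T G z t\<bar> > l} = (\<Union>g\<in>{g\<in>G. l < z g}. T g \<inter> space \<mu>)" for T
    using step_fun_greater_iff[OF G(1) l, of T z] step_fun_nonneg[OF G(1), of T z] by auto
  show "emeasure \<mu> {t \<in> space \<mu>. \<bar>step_fun S G z t\<bar> > l} = emeasure \<mu> {t \<in> space \<mu>. \<bar>step_fun J G z t\<bar> > l}"
  proof (cases "{g\<in>G. l < z g} = {}")
    case True
    then show ?thesis unfolding level by (simp only: UN_empty)
  next
    case False
    define b where "b = Max {g\<in>G. l < z g}"
    have b: "b \<in> {g\<in>G. l < z g}" unfolding b_def using False G(1) by (intro Max_in) auto
    have le: "g \<le> b" if "g \<in> {g\<in>G. l < z g}" for g
      unfolding b_def using G(1) that by (intro Max_ge) auto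
    have "(\<Union>g\<in>{g\<in>G. l < z g}. S g \<inter> space \<mu>) = S b"
      using b le chain sets.sets_into_space[OF S(1)] by fastforce
    moreover have "(\<Union>g\<in>{g\<in>G. l < z g}. J g \<inter> space \<mu>) = J b"
      using b le by (fastforce simp: init_seg_def)
    ultimately show ?thesis unfolding level using S(2) b by simp
  qed
qed

text \<open>Points are added in increasing order. The largest set chosen so far, \<open>L\<close>,
  lies in \<open>A b\<close> and is not too big, so \<open>intermediate\<close> yields a set of the
  right measure between \<open>L\<close> and \<open>A b\<close>.\<close>

lemma chain_exists:
  assumes "finite G" "G \<subseteq> space \<mu>"
    and "\<And>g g'. g \<in> G \<Longrightarrow> g' \<in> G \<Longrightarrow> g \<le> g' \<Longrightarrow> A g \<subseteq> A g'"
    and "\<And>g. g \<in> G \<Longrightarrow> A g \<in> sets \<mu>" "\<And>g. g \<in> G \<Longrightarrow> emeasure \<mu> (J g) \<le> emeasure \<mu> (A g)"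
  shows "\<exists>S. (\<forall>g\<in>G. S g \<subseteq> A g \<and> S g \<in> sets \<mu> \<and> emeasure \<mu> (S g) = emeasure \<mu> (J g)) \<and>
     (\<forall>g\<in>G. \<forall>g'\<in>G. g \<le> g' \<longrightarrow> S g \<subseteq> S g')"
  using assms
proof (induction G rule: finite_linorder_max_induct)
  case empty
  then show ?case by auto
next
  case (insert b G)
  have "\<exists>S. (\<forall>g\<in>G. S g \<subseteq> A g \<and> S g \<in> sets \<mu> \<and> emeasure \<mu> (S g) = emeasure \<mu> (J g)) \<and>
     (\<forall>g\<in>G. \<forall>g'\<in>G. g \<le> g' \<longrightarrow> S g \<subseteq> S g')"
    using insert.prems by (intro insert.IH) auto
  then obtain S where S': "\<forall>g\<in>G. S g \<subseteq> A g \<and> S g \<in> sets \<mu> \<and> emeasure \<mu> (S g) = emeasure \<mu> (J g)"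
     "\<forall>g\<in>G. \<forall>g'\<in>G. g \<le> g' \<longrightarrow> S g \<subseteq> S g'" by (elim exE conjE)
  note S = S'(1)[rule_format] S'(2)[rule_format]
  define L where "L = (if G = {} then {} else S (Max G))"
  have b: "b \<in> space \<mu>" "A b \<in> sets \<mu>" "emeasure \<mu> (J b) \<le> emeasure \<mu> (A b)" using insert.prems by auto
  have L: "L \<in> sets \<mu> \<and> L \<subseteq> A b \<and> emeasure \<mu> L \<le> emeasure \<mu> (J b) \<and> (\<forall>g\<in>G. S g \<subseteq> L)"
  proof (cases "G = {}")
    case False
    then have M: "Max G \<in> G" using insert.hyps by simp
    have "Max G \<le> b" using M insert.hyps by (simp add: less_imp_le)
    then have "S (Max G) \<subseteq> A b" using S(1)[OF M] insert.prems(2)[of "Max G" b] M by auto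
    moreover have "emeasure \<mu> (S (Max G)) \<le> emeasure \<mu> (J b)"
      using S(1)[OF M] M insert.hyps by (simp add: emeasure_mono J_mono less_imp_le)
    moreover have "\<forall>g\<in>G. S g \<subseteq> S (Max G)" using S(2) M insert.hyps by simp
    ultimately show ?thesis using False S(1)[OF M] by (simp add: L_def)
  qed (simp add: L_def)
  then obtain B where B: "B \<in> sets \<mu>" "L \<subseteq> B" "B \<subseteq> A b" "emeasure \<mu> B = emeasure \<mu> (J b)"
    using intermediate[OF b(1), of L "A b"] b by blast
  have nb: "b \<notin> G" using insert.hyps by blast
  show ?case
  proof (intro exI[of _ "S(b := B)"] conjI ballI impI)
    fix g assume "g \<in> insert b G"
    then show "(S(b := B)) g \<subseteq> A g" "(S(b := B)) g \<in> sets \<mu>" "emeasure \<mu> ((S(b := B)) g) = emeasure \<mu> (J g)"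
      using S(1) B by auto
  next
    fix g g' assume "g \<in> insert b G" "g' \<in> insert b G" "g \<le> g'"
    then show "(S(b := B)) g \<subseteq> (S(b := B)) g'"
      using S(2)[of g g'] L B(2) nb insert.hyps(2) by (cases "g = b"; cases "g' = b") (force dest: leD)+
  qed
qed

text \<open>An enumeration of \<open>D\<close> cut off at \<open>n\<close> gives nested grids, hence
  increasing step approximations, as the Fatou property requires. Convergence comes from
  \<open>D_dense\<close>: a grid point slightly to the right of t already has nearly the height
  z(t).\<close>

definition grid :: "nat \<Rightarrow> 'a set" where
  "grid n = from_nat_into D ` {..n}"

lemma grid: "finite (grid n)" "grid n \<subseteq> space \<mu>" "i \<le> n \<Longrightarrow> grid i \<subseteq> grid n"
  using D from_nat_into[of D] by (auto simp: grid_def)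

lemma step_grid_incseq: "incseq (\<lambda>n. step_fun J (grid n) z t)"
proof (rule incseq_SucI)
  fix n
  show "step_fun J (grid n) z t \<le> step_fun J (grid (Suc n)) z t"
    using grid(3)[of n "Suc n"] unfolding step_fun_def by (intro Max_mono) (auto simp: grid(1))
qed

lemma step_grid_tendsto:
  assumes z: "decreasing z"
  shows "AE t in \<mu>. (\<lambda>n. step_fun J (grid n) z t) \<longlonglongrightarrow> z t"
proof -
  have "AE t in \<mu>. \<forall>e>0. \<exists>g\<in>D. t \<le> g \<and> z t - e < z g"
    by (rule D_dense) (rule decreasingD[OF z])
  then show ?thesis using AE_space
  proof eventually_elim
    case (elim t)
    show ?case
    proof (rule LIMSEQ_I)
      fix e :: real assume "0 < e"
      then obtain g where g: "g \<in> D" "t \<le> g" "z t - e < z g" using elim by blast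
      obtain N where N: "g = from_nat_into D N" using g(1) D by (metis from_nat_into_surj)
      have "norm (step_fun J (grid n) z t - z t) < e" if "n \<ge> N" for n
      proof -
        have "z g \<le> step_fun J (grid n) z t"
          using that N g elim by (intro step_fun_upper) (auto simp: grid_def init_seg_def)
        then show ?thesis using g(3) step_fun_le[OF grid(1,2) z, of t n] elim by simp
      qed
      then show "\<exists>no. \<forall>n\<ge>no. norm (step_fun J (grid n) z t - z t) < e" by blast
    qed
  qed
qed

subsection \<open>Rearrangement by transplantation\<close>

definition admissible :: "'a fspace \<Rightarrow> bool" where
  "admissible E \<longleftrightarrow> symmetric_banach_space \<mu> E \<and> fatou_property \<mu> E \<and>
     (\<forall>x\<in>carr E. Hd x \<and> H x \<in> carr E) \<and> (\<exists>C. \<forall>x\<in>carr E. nrm E (H x) \<le> C * nrm E x)"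

definition ces :: "'a fspace \<Rightarrow> 'a fspace" where
  "ces E = FSpace {f \<in> borel_measurable \<mu>. Hd (\<lambda>s. \<bar>f s\<bar>) \<and> H (\<lambda>s. \<bar>f s\<bar>) \<in> carr E}
     (\<lambda>f. nrm E (H (\<lambda>s. \<bar>f s\<bar>)))"

lemma admissible_banach: "admissible E \<Longrightarrow> banach_ideal_space \<mu> E"
  by (auto simp: admissible_def symmetric_banach_space_def)

lemma admissible_ideal: "admissible E \<Longrightarrow> ideal_fspace \<mu> E"
  by (rule banach_ideal_imp_ideal_fspace) (rule admissible_banach)

lemma admissible_symmetric:
  "admissible E \<Longrightarrow> x \<in> carr E \<Longrightarrow> y \<in> borel_measurable \<mu> \<Longrightarrow> equimeasurable \<mu> x y \<Longrightarrow>
    y \<in> carr E \<and> nrm E y = nrm E x"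
  by (auto simp: admissible_def symmetric_banach_space_def)

lemma admissible_fatou:
  assumes E: "admissible E" and X: "\<And>n. X n \<in> carr E" and x: "x \<in> borel_measurable \<mu>"
    and lim: "AE t in \<mu>. (\<forall>n. 0 \<le> X n t) \<and> incseq (\<lambda>n. X n t) \<and> (\<lambda>n. X n t) \<longlonglongrightarrow> x t"
    and K: "\<And>n. nrm E (X n) \<le> K"
  shows "x \<in> carr E \<and> nrm E x \<le> K"
proof -
  have "fatou_property \<mu> E" using E by (simp add: admissible_def)
  moreover have "bdd_above (range (\<lambda>n. nrm E (X n)))" using K by (auto intro!: bdd_aboveI)
  ultimately have "x \<in> carr E \<and> incseq (\<lambda>n. nrm E (X n)) \<and> (\<lambda>n. nrm E (X n)) \<longlonglongrightarrow> nrm E x"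
    unfolding fatou_property_def using X lim by (elim allE[of _ X] ballE[of _ _ x]) (use x in auto)
  then show ?thesis using K by (auto intro: LIMSEQ_le_const2)
qed

lemma admissible_H: "admissible E \<Longrightarrow> x \<in> carr E \<Longrightarrow> Hd x" "admissible E \<Longrightarrow> x \<in> carr E \<Longrightarrow> H x \<in> carr E"
  by (auto simp: admissible_def)

lemma admissible_H_bound:
  assumes "admissible E"
  shows "\<exists>C\<ge>0. \<forall>x\<in>carr E. nrm E (H x) \<le> C * nrm E x"
proof -
  obtain C where C: "\<forall>x\<in>carr E. nrm E (H x) \<le> C * nrm E x" using assms by (auto simp: admissible_def)
  have "nrm E (H x) \<le> \<bar>C\<bar> * nrm E x" if "x \<in> carr E" for x
    using C that ideal_fspace.nrm_nonneg[OF admissible_ideal[OF assms] that]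
    by (meson abs_ge_self mult_right_mono order_trans)
  then show ?thesis by (intro exI[of _ "\<bar>C\<bar>"]) auto
qed

section \<open>Elementary estimates for the Hardy operator\<close>

lemma H_mono_local:
  assumes x: "x \<in> borel_measurable \<mu>" "\<And>s. 0 \<le> x s" "Hd x"
    and st: "s \<in> space \<mu>" "t \<in> space \<mu>" "s \<le> t"
  shows "H x s * m s \<le> H x t * m t"
proof -
  have "(\<integral>\<^sup>+u\<in>J s. ennreal (x u) \<partial>\<mu>) \<le> (\<integral>\<^sup>+u\<in>J t. ennreal (x u) \<partial>\<mu>)"
    using J_mono[OF st(3)] by (intro nn_integral_mono) (auto simp: indicator_def)
  then show ?thesis using H_eq[OF x] st H_nonneg[OF x st(2)] by (simp add: ennreal_le_iff)
qed

text \<open>\<open>H x\<close> is a quotient of two increasing functions on the space, namely the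
  integral over \<open>J t\<close> and the measure of \<open>J t\<close>.\<close>

lemma H_measurable:
  assumes x: "x \<in> borel_measurable \<mu>" "\<And>s. 0 \<le> x s" "Hd x"
  shows "H x \<in> borel_measurable \<mu>"
proof -
  have "(\<lambda>t. (H x t * m t) / m t) \<in> borel_measurable \<mu>"
    using H_mono_local[OF x] m_mono by (intro borel_measurable_divide monotone_measurable)
  moreover have "H x t = (H x t * m t) / m t" if "t \<in> space \<mu>" for t using m_pos[OF that] by simp
  ultimately show ?thesis by (subst measurable_cong)
qed

lemma H_mono:
  assumes x: "x \<in> borel_measurable \<mu>" "\<And>s. 0 \<le> x s"
    and y: "y \<in> borel_measurable \<mu>" "\<And>s. 0 \<le> y s" "Hd y" and le: "AE s in \<mu>. x s \<le> y s"
  shows "Hd x" "t \<in> space \<mu> \<Longrightarrow> H x t \<le> H y t"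
proof -
  have I: "(\<integral>\<^sup>+u\<in>J t. ennreal (x u) \<partial>\<mu>) \<le> (\<integral>\<^sup>+u\<in>J t. ennreal (y u) \<partial>\<mu>)" for t
    using le by (intro nn_integral_mono_AE) (auto simp: indicator_def elim!: eventually_mono intro: ennreal_leI)
  show Hdx: "Hd x" unfolding Hd_iff[OF x] using I y(3) Hd_iff[OF y(1,2)] le_less_trans by blast
  show "H x t \<le> H y t" if t: "t \<in> space \<mu>"
    using I[of t] unfolding H_eq[OF x Hdx t] H_eq[OF y t]
    using H_nonneg[OF y t] m_pos[OF t] by (simp add: ennreal_le_iff)
qed

lemma H_scale:
  assumes x: "x \<in> borel_measurable \<mu>" "\<And>s. 0 \<le> x s" "Hd x" and a: "0 \<le> a"
  shows "Hd (\<lambda>s. a * x s)" "t \<in> space \<mu> \<Longrightarrow> H (\<lambda>s. a * x s) t = a * H x t"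
proof -
  have ax: "(\<lambda>s. a * x s) \<in> borel_measurable \<mu>" "\<And>s. 0 \<le> a * x s" using x a by auto
  have I: "(\<integral>\<^sup>+u\<in>J t. ennreal (a * x u) \<partial>\<mu>) = ennreal a * (\<integral>\<^sup>+u\<in>J t. ennreal (x u) \<partial>\<mu>)" for t
    using a x by (subst nn_integral_cmult[symmetric]) (auto simp: ennreal_mult ac_simps)
  show Hda: "Hd (\<lambda>s. a * x s)"
    unfolding Hd_iff[OF ax] I using x(3) Hd_iff[OF x(1,2)] by (auto simp: ennreal_mult_less_top)
  show "H (\<lambda>s. a * x s) t = a * H x t" if t: "t \<in> space \<mu>"
    using I[of t] unfolding H_eq[OF x t] H_eq[OF ax Hda t]
    using H_nonneg[OF x t] H_nonneg[OF ax Hda t] m_pos[OF t] a by (simp flip: ennreal_mult)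
qed

text \<open>From \<open>t\<close> to \<open>u\<close> the integral over the initial segment does not
  decrease, while its measure at most doubles.\<close>

lemma H_double:
  assumes x: "x \<in> borel_measurable \<mu>" "\<And>s. 0 \<le> x s" "Hd x"
    and t: "t \<in> space \<mu>" "t' \<in> space \<mu>" "m t' = 2 * m t" and u: "u \<in> J t' - J t"
  shows "H x t \<le> 2 * H x u"
proof -
  have u': "u \<in> space \<mu>" "t \<le> u" "u \<le> t'" using u by (auto simp: init_seg_def)
  have "H x t * m t \<le> H x u * m u" using H_mono_local[OF x t(1) u'(1,2)] .
  also have "\<dots> \<le> H x u * (2 * m t)"
    using m_mono[OF u'(1) t(2) u'(3)] t(3) H_nonneg[OF x u'(1)] by (intro mult_left_mono) auto
  finally have "H x t * m t \<le> (2 * H x u) * m t" by simp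
  then show ?thesis using m_pos[OF t(1)] by simp
qed

lemma H_pos:
  assumes x: "x \<in> borel_measurable \<mu>" "\<And>s. 0 \<le> x s" "Hd x" "AE s in \<mu>. 0 < x s" and t: "t \<in> space \<mu>"
  shows "0 < H x t"
proof (rule ccontr)
  assume "\<not> ?thesis"
  then have "H x t = 0" using H_nonneg[OF x(1-3) t] by simp
  then have "(\<integral>\<^sup>+u\<in>J t. ennreal (x u) \<partial>\<mu>) = 0" using H_eq[OF x(1-3) t] by simp
  then have "AE u in \<mu>. ennreal (x u) * indicator (J t) u = 0"
    using x(1) by (subst (asm) nn_integral_0_iff_AE) auto
  with x(4) have "AE u in \<mu>. u \<notin> J t"
    by eventually_elim (auto simp: indicator_def)
  then have "emeasure \<mu> (J t) = 0" by (subst (asm) AE_iff_measurable[OF J_sets, of _ t]) (auto simp: init_seg_def)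
  then show False using init_seg_pos[OF t] by simp
qed

section \<open>Indicators and bounds on heights\<close>

lemma equimeasurable_indicator:
  assumes "A \<in> sets \<mu>" "B \<in> sets \<mu>" "emeasure \<mu> A = emeasure \<mu> B"
  shows "equimeasurable \<mu> (indicator A) (indicator B)"
proof -
  have "{t \<in> space \<mu>. l < \<bar>indicator C t :: real\<bar>} = (if l < 1 then C else {})"
    if "C \<in> sets \<mu>" "0 \<le> l" for C l
    using sets.sets_into_space[OF that(1)] that(2) by (auto simp: indicator_def)
  then show ?thesis using assms by (auto simp: equimeasurable_def)
qed

text \<open>Let x be the absolute value of a weak unit. Near the left end \<open>H x\<close> may be
  arbitrarily small, but on the block to the right of \<open>t\<close> it is at least H x t / 2 > 0.
  So the indicator of that block belongs to \<open>E\<close>, and symmetry carries it to every set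
  of the same measure.\<close>

lemma indicator_mem:
  assumes E: "admissible E" and t: "t \<in> space \<mu>" and A: "A \<in> sets \<mu>" "emeasure \<mu> A = emeasure \<mu> (J t)"
  shows "indicator A \<in> carr E" "nrm E (indicator A) = nrm E (indicator (J t))"
proof -
  interpret ideal_fspace \<mu> E by (rule admissible_ideal[OF E])
  obtain w where w: "w \<in> carr E" "AE t in \<mu>. 0 < w t"
    using admissible_banach[OF E] by (auto simp: banach_ideal_space_def)
  define x where "x = (\<lambda>t. \<bar>w t\<bar>)"
  have x: "x \<in> carr E" "x \<in> borel_measurable \<mu>" "\<And>s. 0 \<le> x s" "Hd x" "AE s in \<mu>. 0 < x s"
    using abs_mem(1)[OF w(1)] meas[of x] admissible_H(1)[OF E, of x] w(2) by (auto simp: x_def elim: eventually_mono)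
  have pos: "0 < H x t" by (rule H_pos[OF x(2-5) t])
  obtain t' where t': "t' \<in> space \<mu>" "t < t'" "m t' = 2 * m t" "emeasure \<mu> (J t' - J t) = emeasure \<mu> (J t)"
    using less_space[OF t] by blast
  have "(indicator (J t' - J t) :: 'a \<Rightarrow> real) \<in> carr E"
  proof (rule scaled_mem(1))
    show "H x \<in> carr E" by (rule admissible_H(2)[OF E x(1)])
    show "AE s in \<mu>. \<bar>indicator (J t' - J t) s\<bar> \<le> (2 / H x t) * \<bar>H x s\<bar>"
    proof (rule AE_I2)
      fix s
      show "\<bar>indicator (J t' - J t) s\<bar> \<le> (2 / H x t) * \<bar>H x s\<bar>"
        using H_double[OF x(2-4) t t'(1,3), of s] pos by (auto simp: indicator_def field_simps)
    qed
  qed (use pos in auto)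
  then show "indicator A \<in> carr E" "nrm E (indicator A) = nrm E (indicator (J t))"
    using admissible_symmetric[OF E, of "indicator (J t' - J t)"] A t'(4) equimeasurable_indicator
    by (metis J_sets borel_measurable_indicator sets.Diff)+
qed

lemma indicator_nrm_pos:
  assumes E: "admissible E" and t: "t \<in> space \<mu>"
  shows "0 < nrm E (indicator (J t))"
proof -
  interpret ideal_fspace \<mu> E by (rule admissible_ideal[OF E])
  have i: "indicator (J t) \<in> carr E" using indicator_mem(1)[OF E t J_sets] by simp
  have "nrm E (indicator (J t)) \<noteq> 0"
  proof
    assume "nrm E (indicator (J t)) = 0"
    then have "AE s in \<mu>. indicator (J t) s = (0::real)" using nrm_zero_iff[OF i] by simp
    then have "AE s in \<mu>. s \<notin> J t" by eventually_elim (auto simp: indicator_def split: if_splits)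
    then have "emeasure \<mu> (J t) = 0" by (subst (asm) AE_iff_measurable[OF J_sets, of _ t]) (auto simp: init_seg_def)
    then show False using init_seg_pos[OF t] by simp
  qed
  then show ?thesis using nrm_nonneg[OF i] by simp
qed

text \<open>It makes the suprema finite that define the decreasing majorant and the rearranged
  multiplier.\<close>

lemma height_bound:
  assumes E: "admissible E" and t: "t \<in> space \<mu>" and A: "A \<in> sets \<mu>" "emeasure \<mu> (J t) \<le> emeasure \<mu> A"
    and x: "x \<in> carr E" and c: "0 \<le> c" "\<And>s. s \<in> A \<Longrightarrow> c \<le> \<bar>x s\<bar>"
  shows "c * nrm E (indicator (J t)) \<le> nrm E x"
proof -
  interpret ideal_fspace \<mu> E by (rule admissible_ideal[OF E])
  obtain B where B: "B \<in> sets \<mu>" "B \<subseteq> A" "emeasure \<mu> B = emeasure \<mu> (J t)"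
    using intermediate[OF t, of "{}" A] A by auto
  have "nrm E (\<lambda>s. c * indicator B s) \<le> nrm E x"
    using B c x by (intro nrm_mono) (auto simp: indicator_def intro!: AE_I2)
  then show ?thesis using nrm_scale[OF indicator_mem(1)[OF E t B(1,3)], of c] indicator_mem(2)[OF E t B(1,3)] c
    by simp
qed

text \<open>
  Step approximations of \<open>w\<close> and \<open>y\<close> are moved from initial segments to a chain of sets
  of the same measures on which \<open>h\<close> exceeds the steps of \<open>w\<close>. This avoids decreasing
  rearrangements and measure-preserving maps.
\<close>

lemma transplant:
  assumes F: "admissible F" and w: "decreasing w" and y: "decreasing y"
    and h: "h \<in> borel_measurable \<mu>" "\<And>t. 0 \<le> h t"
    and level: "\<And>t. t \<in> space \<mu> \<Longrightarrow> emeasure \<mu> (J t) \<le> emeasure \<mu> {s \<in> space \<mu>. w t \<le> h s}"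
    and hy: "\<And>y' z. y' \<in> borel_measurable \<mu> \<Longrightarrow> z \<in> borel_measurable \<mu> \<Longrightarrow> (\<And>t. 0 \<le> y' t) \<Longrightarrow>
       (\<And>t. t \<in> space \<mu> \<Longrightarrow> 0 \<le> z t \<and> z t \<le> y t) \<Longrightarrow> equimeasurable \<mu> z y' \<Longrightarrow>
       (\<lambda>t. h t * y' t) \<in> carr F \<and> nrm F (\<lambda>t. h t * y' t) \<le> K"
  shows "(\<lambda>t. w t * y t) \<in> carr F \<and> nrm F (\<lambda>t. w t * y t) \<le> K"
proof -
  interpret ideal_fspace \<mu> F by (rule admissible_ideal[OF F])
  let ?z = "\<lambda>t. w t * y t"
  have wy: "decreasing ?z" by (rule decreasing_mult[OF w y])
  have st: "step_fun J (grid n) ?z \<in> carr F \<and> nrm F (step_fun J (grid n) ?z) \<le> K" for n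
  proof -
    let ?G = "grid n"
    have "\<exists>S. (\<forall>g\<in>?G. S g \<subseteq> {s \<in> space \<mu>. w g \<le> h s} \<and> S g \<in> sets \<mu> \<and> emeasure \<mu> (S g) = emeasure \<mu> (J g)) \<and>
       (\<forall>g\<in>?G. \<forall>g'\<in>?G. g \<le> g' \<longrightarrow> S g \<subseteq> S g')"
    proof (rule chain_exists[OF grid(1,2)])
      fix g g' assume "g \<in> ?G" "g' \<in> ?G" "g \<le> g'"
      then have "w g' \<le> w g" using grid(2) by (intro decreasingD[OF w]) auto
      then show "{s \<in> space \<mu>. w g \<le> h s} \<subseteq> {s \<in> space \<mu>. w g' \<le> h s}" by auto
    next
      fix g assume "g \<in> ?G"
      then show "emeasure \<mu> (J g) \<le> emeasure \<mu> {s \<in> space \<mu>. w g \<le> h s}" using grid(2) level by blast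
    qed (use h in measurable)
    then obtain S where S': "\<forall>g\<in>?G. S g \<subseteq> {s \<in> space \<mu>. w g \<le> h s} \<and> S g \<in> sets \<mu> \<and> emeasure \<mu> (S g) = emeasure \<mu> (J g)"
       "\<forall>g\<in>?G. \<forall>g'\<in>?G. g \<le> g' \<longrightarrow> S g \<subseteq> S g'" by (elim exE conjE)
    note S = S'(1)[rule_format] S'(2)[rule_format]
    have eq: "equimeasurable \<mu> (step_fun S ?G v) (step_fun J ?G v)" if "decreasing v" for v
      using S that by (intro equimeasurable_step_fun[OF grid(1,2)]) blast+
    have Jm: "step_fun J ?G v \<in> borel_measurable \<mu>" for v by (rule step_fun_measurable[OF grid(1)]) simp
    have Sm: "step_fun S ?G v \<in> borel_measurable \<mu>" for v using S(1) by (intro step_fun_measurable[OF grid(1)]) blast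
    \<comment> \<open>What is transplanted is an approximation of \<open>y\<close> from below; hence
      \<open>hy\<close> speaks of functions equimeasurable with some \<open>z\<close> below
      \<open>y\<close>.\<close>
    have hyS: "(\<lambda>t. h t * step_fun S ?G y t) \<in> carr F \<and> nrm F (\<lambda>t. h t * step_fun S ?G y t) \<le> K"
    proof (rule hy[where z = "step_fun J ?G y"])
      show "0 \<le> step_fun J ?G y t \<and> step_fun J ?G y t \<le> y t" if "t \<in> space \<mu>" for t
        using step_fun_nonneg[OF grid(1)] step_fun_le[OF grid(1,2) y that] by simp
      show "equimeasurable \<mu> (step_fun J ?G y) (step_fun S ?G y)"
        using eq[OF y] by (simp add: equimeasurable_def)
    qed (use Jm Sm step_fun_nonneg[OF grid(1)] in auto)
    \<comment> \<open>On \<open>S g\<close> the function \<open>h\<close> is at least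
      \<open>w g\<close>, so each transplanted height w g * y g is bounded by \<open>h\<close> times
      the transplanted \<open>y\<close>.\<close>
    have "step_fun S ?G ?z t \<le> h t * step_fun S ?G y t" for t
    proof (rule step_fun_least[OF grid(1)])
      show "0 \<le> h t * step_fun S ?G y t" using h(2) step_fun_nonneg[OF grid(1)] by simp
      fix g assume g: "g \<in> ?G" "t \<in> S g"
      then have "w g \<le> h t" using S(1) by blast
      then show "w g * y g \<le> h t * step_fun S ?G y t"
        using step_fun_upper[of ?G g t S y, OF grid(1) g] decreasing_nonneg[OF y] h(2) by (intro mult_mono) auto
    qed
    then have "AE t in \<mu>. \<bar>step_fun S ?G ?z t\<bar> \<le> \<bar>h t * step_fun S ?G y t\<bar>"
      using step_fun_nonneg[OF grid(1)] h(2) by (intro AE_I2) (simp add: abs_mult)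
    from ideal_mem[OF _ Sm this] nrm_mono[OF _ Sm this] hyS
    have "step_fun S ?G ?z \<in> carr F" "nrm F (step_fun S ?G ?z) \<le> K" by auto
    \<comment> \<open>Symmetry of \<open>F\<close> moves the steps of w y back to initial segments
      with the same norm.\<close>
    then show ?thesis using admissible_symmetric[OF F _ Jm eq[OF wy]] by auto
  qed
  have "AE t in \<mu>. (\<forall>n. 0 \<le> step_fun J (grid n) ?z t) \<and> incseq (\<lambda>n. step_fun J (grid n) ?z t) \<and>
      (\<lambda>n. step_fun J (grid n) ?z t) \<longlonglongrightarrow> ?z t"
    using step_grid_tendsto[OF wy] step_grid_incseq step_fun_nonneg[OF grid(1)] by auto
  from admissible_fatou[OF F _ decreasing_measurable[OF wy] this] st show ?thesis by blast
qed

text \<open>One factor 2 of the constant 4 comes from a point \<open>s\<close> \<ge>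
  \<open>t\<close> where \<open>H x\<close> exceeds half the supremum q t, the other from
  \<open>H_double\<close> on the block after \<open>s\<close>. That block is at least as large as
  \<open>J t\<close>, so \<open>transplant\<close> applies with 4 |H x| in the role of
  \<open>h\<close>.\<close>

lemma decreasing_majorant:
  assumes E: "admissible E" and x: "x \<in> borel_measurable \<mu>" "\<And>s. 0 \<le> x s" "Hd x" and Hx: "H x \<in> carr E"
  shows "\<exists>q. decreasing q \<and> q \<in> carr E \<and> nrm E q \<le> 4 * nrm E (H x) \<and> (\<forall>t\<in>space \<mu>. H x t \<le> q t)"
proof -
  interpret ideal_fspace \<mu> E by (rule admissible_ideal[OF E])
  let ?A = "\<lambda>t. {s \<in> space \<mu>. t \<le> s}"
  define q where "q t = (if t \<in> space \<mu> then SUP s\<in>?A t. H x s else 0)" for t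
  \<comment> \<open>Half of the value at \<open>s\<close> persists on a block of measure at least
    that of \<open>J t\<close>; the norm of \<open>H x\<close> therefore bounds it uniformly in s
    \<ge> t.\<close>
  have bound: "H x s \<le> 2 * nrm E (H x) / nrm E (indicator (J t))" if t: "t \<in> space \<mu>" "s \<in> ?A t" for s t
  proof -
    obtain s' where s': "s' \<in> space \<mu>" "m s' = 2 * m s" "emeasure \<mu> (J s' - J s) = emeasure \<mu> (J s)"
      using less_space[of s] t by blast
    have "H x s / 2 * nrm E (indicator (J t)) \<le> nrm E (H x)"
    proof (rule height_bound[OF E t(1) _ _ Hx])
      show "J s' - J s \<in> sets \<mu>" by simp
      show "emeasure \<mu> (J t) \<le> emeasure \<mu> (J s' - J s)"
        unfolding s'(3) using t by (intro emeasure_mono J_mono) auto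
      show "0 \<le> H x s / 2" using H_nonneg[OF x] t by simp
      show "H x s / 2 \<le> \<bar>H x u\<bar>" if "u \<in> J s' - J s" for u
        using H_double[OF x _ s'(1,2) that] t by simp
    qed
    then show ?thesis using indicator_nrm_pos[OF E t(1)] by (simp add: field_simps)
  qed
  then have bdd: "bdd_above (H x ` ?A t)" if "t \<in> space \<mu>" for t using that by (auto intro!: bdd_aboveI)
  have le: "H x s \<le> q t" if "t \<in> space \<mu>" "s \<in> ?A t" for s t
    using that bdd[OF that(1)] unfolding q_def by (auto intro!: cSUP_upper)
  have dec: "decreasing q"
    unfolding decreasing_def
  proof (intro conjI allI ballI impI)
    fix t
    show "0 \<le> q t"
      using le[of t t] H_nonneg[OF x, of t] by (cases "t \<in> space \<mu>") (auto simp: q_def)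
  next
    fix s t assume "s \<in> space \<mu>" "t \<in> space \<mu>" "s \<le> t"
    then show "q t \<le> q s" unfolding q_def using bdd[of s] by (auto intro!: cSUP_subset_mono)
  qed
  have Hm: "H x \<in> borel_measurable \<mu>" by (rule H_measurable[OF x])
  \<comment> \<open>The second decreasing function is the constant 1, which need not belong to
    \<open>E\<close>; only functions below it, multiplied by \<open>H x\<close>, are tested.\<close>
  have "(\<lambda>t. q t * 1) \<in> carr E \<and> nrm E (\<lambda>t. q t * 1) \<le> 4 * nrm E (H x)"
  proof (rule transplant[OF E dec, where h = "\<lambda>t. 4 * \<bar>H x t\<bar>"])
    fix t assume t: "t \<in> space \<mu>"
    show "emeasure \<mu> (J t) \<le> emeasure \<mu> {s \<in> space \<mu>. q t \<le> 4 * \<bar>H x s\<bar>}"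
    proof (cases "q t = 0")
      case True
      then show ?thesis by (intro emeasure_mono) (auto simp: init_seg_def)
    next
      case False
      then have pos: "0 < q t" using decreasing_nonneg[OF dec, of t] by simp
      obtain s where s: "s \<in> ?A t" "q t / 2 < H x s"
        using pos t less_cSUP_iff[OF _ bdd[OF t], of "q t / 2"] by (force simp: q_def)
      obtain s' where s': "s' \<in> space \<mu>" "m s' = 2 * m s" "emeasure \<mu> (J s' - J s) = emeasure \<mu> (J s)"
        using less_space[of s] s by blast
      have "emeasure \<mu> (J t) \<le> emeasure \<mu> (J s)" using s by (intro emeasure_mono J_mono) auto
      also have "\<dots> \<le> emeasure \<mu> {s \<in> space \<mu>. q t \<le> 4 * \<bar>H x s\<bar>}"
        unfolding s'(3)[symmetric]
      proof (rule emeasure_mono)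
        show "J s' - J s \<subseteq> {s \<in> space \<mu>. q t \<le> 4 * \<bar>H x s\<bar>}"
        proof
          fix u assume u: "u \<in> J s' - J s"
          then have "H x s \<le> 2 * H x u" using H_double[OF x _ s'(1,2)] s by blast
          then show "u \<in> {s \<in> space \<mu>. q t \<le> 4 * \<bar>H x s\<bar>}" using u s(2) by (auto simp: init_seg_def)
        qed
      qed (use Hm in measurable)
      finally show ?thesis .
    qed
  next
    fix y' z
    assume y': "y' \<in> borel_measurable \<mu>" "z \<in> borel_measurable \<mu>" "\<And>t. 0 \<le> y' t"
      and z: "\<And>t. t \<in> space \<mu> \<Longrightarrow> 0 \<le> z t \<and> z t \<le> (1::real)" and eq: "equimeasurable \<mu> z y'"
    \<comment> \<open>Equimeasurability at the level 1 alone shows that \<open>y'\<close> is at most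
      1 a.e.\<close>
    have "{t \<in> space \<mu>. 1 < \<bar>z t\<bar>} = {}" using z by fastforce
    then have "emeasure \<mu> {t \<in> space \<mu>. 1 < \<bar>y' t\<bar>} = 0"
      using eq unfolding equimeasurable_def by (metis emeasure_empty zero_le_one)
    then have "AE t in \<mu>. \<not> 1 < \<bar>y' t\<bar>" using y'(1) by (subst AE_iff_measurable[OF _ refl]) auto
    then have "AE t in \<mu>. \<bar>4 * \<bar>H x t\<bar> * y' t\<bar> \<le> 4 * \<bar>H x t\<bar>"
      by eventually_elim (auto simp: abs_mult mult_left_le)
    from scaled_mem[OF Hx _ this]
    show "(\<lambda>t. 4 * \<bar>H x t\<bar> * y' t) \<in> carr E \<and> nrm E (\<lambda>t. 4 * \<bar>H x t\<bar> * y' t) \<le> 4 * nrm E (H x)"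
      using Hm y'(1) by auto
  qed (use Hm in \<open>auto simp: decreasing_def\<close>)
  then show ?thesis using dec le by (intro exI[of _ q]) auto
qed

text \<open>2 W(t) is the supremum of the levels that |h| reaches on a set at least as large as
  \<open>J t\<close>, a version of the decreasing rearrangement. Levels above it give smaller sets,
  which is the first property. \<open>W t\<close> is strictly below the supremum or 0, so it is such
  a level itself; this is what \<open>transplant\<close> needs for the second property.\<close>

lemma rearranged_multiplier:
  assumes E: "admissible E" and F: "admissible F" and h: "h \<in> carr (multipliers \<mu> E F)"
  shows "\<exists>W. decreasing W \<and>
    (\<forall>t\<in>space \<mu>. \<forall>l>2 * W t. emeasure \<mu> {s \<in> space \<mu>. l \<le> \<bar>h s\<bar>} < emeasure \<mu> (J t)) \<and>
    (\<forall>y\<in>carr E. decreasing y \<longrightarrow> (\<lambda>t. W t * y t) \<in> carr F \<and>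
       nrm F (\<lambda>t. W t * y t) \<le> nrm (multipliers \<mu> E F) h * nrm E y)"
proof -
  interpret E: ideal_fspace \<mu> E by (rule admissible_ideal[OF E])
  interpret F: ideal_fspace \<mu> F by (rule admissible_ideal[OF F])
  let ?M = "nrm (multipliers \<mu> E F) h"
  have hy: "(\<lambda>t. h t * y t) \<in> carr F" if "y \<in> carr E" for y
    using h that by (auto simp: multipliers_def)
  have hm: "h \<in> borel_measurable \<mu>" using h by (auto simp: multipliers_def)
  let ?S = "\<lambda>l. {s \<in> space \<mu>. l \<le> \<bar>h s\<bar>}"
  let ?L = "\<lambda>t. {l. 0 \<le> l \<and> emeasure \<mu> (J t) \<le> emeasure \<mu> (?S l)}"
  have Sm: "?S l \<in> sets \<mu>" for l using hm by measurable
  define W where "W t = (if t \<in> space \<mu> then Sup (?L t) / 2 else 0)" for t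
  have zero: "0 \<in> ?L t" for t using emeasure_mono[of "J t" "?S 0" \<mu>] Sm[of 0] by (auto simp: init_seg_def)
  \<comment> \<open>Testing the multiplier on the indicator of a part of the level set, of the
    measure of \<open>J t\<close>, bounds all levels and makes the supremum finite.\<close>
  have "l \<le> ?M * nrm E (indicator (J t)) / nrm F (indicator (J t))" if t: "t \<in> space \<mu>" and l: "l \<in> ?L t" for t l
  proof -
    obtain B where B: "B \<in> sets \<mu>" "B \<subseteq> ?S l" "emeasure \<mu> B = emeasure \<mu> (J t)"
      using intermediate[OF t, of "{}" "?S l"] l Sm by auto
    note iE = indicator_mem[OF E t B(1,3)]
    have "l * nrm F (indicator (J t)) \<le> nrm F (\<lambda>t. h t * indicator B t)"
      by (rule height_bound[OF F t B(1) _ hy[OF iE(1)]]) (use B l in auto)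
    also have "\<dots> \<le> ?M * nrm E (indicator (J t))"
      using multiplier_bound[OF admissible_ideal[OF E] admissible_ideal[OF F] h iE(1)] iE(2) by simp
    finally show ?thesis using indicator_nrm_pos[OF F t] by (simp add: field_simps)
  qed
  then have bdd: "bdd_above (?L t)" if "t \<in> space \<mu>" for t using that by (intro bdd_aboveI) blast
  have dec: "decreasing W"
    unfolding decreasing_def
  proof (intro conjI allI ballI impI)
    fix t
    show "0 \<le> W t" using cSup_upper[OF zero[of t] bdd] by (auto simp: W_def)
  next
    fix s t assume st: "s \<in> space \<mu>" "t \<in> space \<mu>" "s \<le> t"
    have "?L t \<subseteq> ?L s" using emeasure_mono[OF J_mono[OF st(3)] J_sets] by (auto intro: order_trans)
    then have "Sup (?L t) \<le> Sup (?L s)" using zero[of t] bdd[OF st(1)] by (intro cSup_subset_mono) auto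
    then show "W t \<le> W s" using st by (simp add: W_def)
  qed
  have small: "emeasure \<mu> (?S l) < emeasure \<mu> (J t)" if t: "t \<in> space \<mu>" and l: "2 * W t < l" for t l
  proof (rule ccontr)
    assume "\<not> ?thesis"
    then have "l \<in> ?L t" using l decreasing_nonneg[OF dec, of t] by auto
    then have "l \<le> Sup (?L t)" by (rule cSup_upper[OF _ bdd[OF t]])
    then show False using l t by (simp add: W_def)
  qed
  have large: "emeasure \<mu> (J t) \<le> emeasure \<mu> {s \<in> space \<mu>. W t \<le> \<bar>h s\<bar>}" if t: "t \<in> space \<mu>" for t
  proof (cases "W t = 0")
    case True
    then show ?thesis using zero[of t] by simp
  next
    case False
    then have "W t < Sup (?L t)" using decreasing_nonneg[OF dec, of t] t by (simp add: W_def)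
    then obtain l where l: "l \<in> ?L t" "W t < l"
      using less_cSup_iff[OF _ bdd[OF t]] zero[of t] by blast
    then have "emeasure \<mu> (J t) \<le> emeasure \<mu> (?S l)" by simp
    also have "\<dots> \<le> emeasure \<mu> (?S (W t))" using l(2) Sm by (intro emeasure_mono) auto
    finally show ?thesis .
  qed
  have "(\<lambda>t. W t * y t) \<in> carr F \<and> nrm F (\<lambda>t. W t * y t) \<le> ?M * nrm E y"
    if y: "y \<in> carr E" "decreasing y" for y
  proof (rule transplant[OF F dec y(2), where h = "\<lambda>t. \<bar>h t\<bar>"])
    fix y' z
    assume y': "y' \<in> borel_measurable \<mu>" "z \<in> borel_measurable \<mu>" "\<And>t. 0 \<le> y' t"
      and z: "\<And>t. t \<in> space \<mu> \<Longrightarrow> 0 \<le> z t \<and> z t \<le> y t" and eq: "equimeasurable \<mu> z y'"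
    have "AE t in \<mu>. \<bar>z t\<bar> \<le> \<bar>y t\<bar>" using z by (intro AE_I2) fastforce
    then have z': "z \<in> carr E" "nrm E z \<le> nrm E y" using E.ideal_mem E.nrm_mono y(1) y'(2) by blast+
    then have y'E: "y' \<in> carr E" "nrm E y' \<le> nrm E y" using admissible_symmetric[OF E _ y'(1) eq] by auto
    have "nrm F (\<lambda>t. h t * y' t) \<le> ?M * nrm E y"
    proof -
      have "nrm F (\<lambda>t. h t * y' t) \<le> ?M * nrm E y'"
        by (rule multiplier_bound[OF admissible_ideal[OF E] admissible_ideal[OF F] h y'E(1)])
      also have "\<dots> \<le> ?M * nrm E y"
      proof (rule mult_left_mono[OF y'E(2)])
        obtain t where "t \<in> space \<mu>" using D by blast
        then show "0 \<le> ?M"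
          using multipliers_nrm_nonneg[OF admissible_ideal[OF E] admissible_ideal[OF F] h indicator_mem(1)[OF E _ J_sets refl]]
            indicator_nrm_pos[OF E] by (metis less_irrefl)
      qed
      finally show ?thesis .
    qed
    moreover have "AE t in \<mu>. \<bar>\<bar>h t\<bar> * y' t\<bar> = \<bar>h t * y' t\<bar>" by (simp add: abs_mult)
    ultimately show "(\<lambda>t. \<bar>h t\<bar> * y' t) \<in> carr F \<and> nrm F (\<lambda>t. \<bar>h t\<bar> * y' t) \<le> ?M * nrm E y"
      using F.cong_mem[OF hy[OF y'E(1)], of "\<lambda>t. \<bar>h t\<bar> * y' t"] hm y'(1) by auto
  qed (use hm large in auto)
  then show ?thesis using dec small by (intro exI[of _ W]) blast
qed

subsection \<open>Factorization of Cesaro spaces\<close>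

lemma H_ge_decreasing:
  assumes v: "decreasing v" "Hd v" and t: "t \<in> space \<mu>"
  shows "v t \<le> H v t"
proof -
  have x: "v \<in> borel_measurable \<mu>" "\<And>s. 0 \<le> v s"
    using decreasing_measurable decreasing_nonneg v by blast+
  have "ennreal (v t * m t) = (\<integral>\<^sup>+u\<in>J t. ennreal (v t) \<partial>\<mu>)"
    using emeasure_J[OF t] x(2) by (simp add: nn_integral_cmult_indicator ennreal_mult)
  also have "\<dots> \<le> (\<integral>\<^sup>+u\<in>J t. ennreal (v u) \<partial>\<mu>)"
    using decreasingD[OF v(1) _ t] by (intro nn_integral_mono) (auto simp: init_seg_def indicator_def intro!: ennreal_leI)
  also have "\<dots> = ennreal (H v t * m t)" by (rule H_eq[OF x v(2) t])
  finally show ?thesis using H_nonneg[OF x v(2) t] m_pos[OF t] by (simp add: ennreal_le_iff)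
qed

text \<open>The weight depends on \<open>h\<close> alone and serves every factorization p = g h with
  \<open>p\<close> decreasing. The constant 4 is a 2 for the half of \<open>J t\<close> that is kept
  and a 2 for the level 2 w(t).\<close>

lemma factor_weight:
  assumes E: "admissible E" and F: "admissible F" and h: "h \<in> carr (multipliers \<mu> E F)"
    and C: "0 \<le> C" "\<forall>x\<in>carr F. nrm F (H x) \<le> C * nrm F x"
  shows "\<exists>w. decreasing w \<and>
    (\<forall>y\<in>carr E. decreasing y \<longrightarrow> (\<lambda>t. w t * y t) \<in> carr F \<and>
       nrm F (\<lambda>t. w t * y t) \<le> 2 * C * nrm (multipliers \<mu> E F) h * nrm E y) \<and>
    (\<forall>p g. decreasing p \<longrightarrow> g \<in> carr E \<longrightarrow> (AE t in \<mu>. p t = g t * h t) \<longrightarrow>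
       (\<forall>t\<in>space \<mu>. p t \<le> 4 * w t * H (\<lambda>s. \<bar>g s\<bar>) t))"
proof -
  interpret E: ideal_fspace \<mu> E by (rule admissible_ideal[OF E])
  interpret F: ideal_fspace \<mu> F by (rule admissible_ideal[OF F])
  let ?M = "nrm (multipliers \<mu> E F) h"
  obtain W where W: "decreasing W"
    "\<forall>t\<in>space \<mu>. \<forall>l>2 * W t. emeasure \<mu> {s \<in> space \<mu>. l \<le> \<bar>h s\<bar>} < emeasure \<mu> (J t)"
    "\<forall>y\<in>carr E. decreasing y \<longrightarrow> (\<lambda>t. W t * y t) \<in> carr F \<and> nrm F (\<lambda>t. W t * y t) \<le> ?M * nrm E y"
    using rearranged_multiplier[OF E F h] by (elim exE conjE)
  define w where "w t = (if t \<in> space \<mu> then W (half t) else 0)" for t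
  have dec: "decreasing w"
    using W(1) half_space half_mono by (auto simp: decreasing_def w_def)
  have "(\<lambda>t. w t * y t) \<in> carr F \<and> nrm F (\<lambda>t. w t * y t) \<le> 2 * C * ?M * nrm E y"
    if y: "y \<in> carr E" "decreasing y" for y
  proof -
    define v where "v = (\<lambda>t. W t * y t)"
    have v: "decreasing v" "v \<in> carr F" "nrm F v \<le> ?M * nrm E y"
      using W y decreasing_mult by (auto simp: v_def)
    have vd: "v \<in> borel_measurable \<mu>" "\<And>s. 0 \<le> v s" "Hd v"
      using decreasing_measurable decreasing_nonneg v admissible_H[OF F] by blast+
    \<comment> \<open>\<open>y\<close> decreases, so w(t) y(t) is at most \<open>v\<close> at
      \<open>half t\<close>. A decreasing function is below its average, and that average at most
      doubles when it is replaced by twice the one at \<open>t\<close>.\<close>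
    have "w t * y t \<le> 2 * H v t" if t: "t \<in> space \<mu>" for t
    proof -
      have "w t * y t \<le> v (half t)"
        using t decreasingD[OF y(2) half_space[OF t] t half_le[OF t]] decreasing_nonneg[OF W(1)]
        by (auto simp: w_def v_def intro: mult_left_mono)
      also have "\<dots> \<le> H v (half t)" by (rule H_ge_decreasing[OF v(1) vd(3) half_space[OF t]])
      finally have "w t * y t * m (half t) \<le> H v (half t) * m (half t)"
        by (rule mult_right_mono) simp
      also have "\<dots> \<le> H v t * m t" by (rule H_mono_local[OF vd half_space[OF t] t half_le[OF t]])
      also have "\<dots> \<le> H v t * (2 * m (half t))"
        using half_measure[OF t] H_nonneg[OF vd t] by (intro mult_left_mono)
      finally have "w t * y t * m (half t) \<le> 2 * H v t * m (half t)" by simp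
      then show ?thesis using m_pos[OF half_space[OF t]] by simp
    qed
    moreover have nn: "0 \<le> w t * y t" for t using decreasing_nonneg dec y(2) by simp
    ultimately have le: "AE t in \<mu>. \<bar>w t * y t\<bar> \<le> 2 * \<bar>H v t\<bar>" by (intro AE_I2) fastforce
    have "nrm F (H v) \<le> C * (?M * nrm E y)"
      using C v(2,3) by (meson mult_left_mono order_trans)
    then show ?thesis
      using F.scaled_mem[OF admissible_H(2)[OF F v(2)] decreasing_measurable[OF decreasing_mult[OF dec y(2)]] le]
      by (auto simp: mult.assoc)
  qed
  moreover have "p t \<le> 4 * w t * H (\<lambda>s. \<bar>g s\<bar>) t"
    if p: "decreasing p" and g: "g \<in> carr E" and eq: "AE t in \<mu>. p t = g t * h t" and t: "t \<in> space \<mu>" for p g t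
  proof -
    have gd: "(\<lambda>s. \<bar>g s\<bar>) \<in> borel_measurable \<mu>" "\<And>s. 0 \<le> \<bar>g s\<bar>" "Hd (\<lambda>s. \<bar>g s\<bar>)"
      using E.meas[OF E.abs_mem(1)[OF g]] admissible_H(1)[OF E E.abs_mem(1)[OF g]] by auto
    let ?c = "H (\<lambda>s. \<bar>g s\<bar>) t"
    have hm [measurable]: "h \<in> borel_measurable \<mu>" using h by (auto simp: multipliers_def)
    have c: "0 \<le> ?c" by (rule H_nonneg[OF gd t])
    \<comment> \<open>The set \<open>A\<close> where |h| is at least \<open>l\<close> fills at most
      half of \<open>J t\<close>. On the rest p(t) \<le> p(s) \<le> l |g(s)|, and integration over
      that rest gives the bound.\<close>
    have *: "p t \<le> 2 * l * ?c" if l: "2 * w t < l" for l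
    proof -
      have lpos: "0 < l" using l decreasing_nonneg[OF dec, of t] by linarith
      define A where "A = {s \<in> space \<mu>. l \<le> \<bar>h s\<bar>}"
      have A [measurable]: "A \<in> sets \<mu>" unfolding A_def by measurable
      have "emeasure \<mu> A < emeasure \<mu> (J (half t))"
        unfolding A_def using W(2) half_space[OF t] l t by (simp add: w_def)
      then have "2 * emeasure \<mu> A \<le> emeasure \<mu> (J t)" by (rule less_half[OF t A])
      moreover have Afin: "emeasure \<mu> A = ennreal (measure \<mu> A)"
        using \<open>emeasure \<mu> A < _\<close> by (intro emeasure_eq_ennreal_measure) auto
      ultimately have "ennreal (2 * measure \<mu> A) \<le> ennreal (m t)"
        using emeasure_J[OF t] by (simp add: ennreal_mult)
      then have a: "2 * measure \<mu> A \<le> m t" by (simp add: ennreal_le_iff)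
      have Jfin: "J t - A \<in> fmeasurable \<mu>" "J t \<in> fmeasurable \<mu>" "A \<in> fmeasurable \<mu>"
        using init_seg_fin[OF t] Afin by (auto intro!: fmeasurableI fmeasurable.Diff)
      have "m t \<le> measure \<mu> ((J t - A) \<union> A)" using Jfin by (intro measure_mono_fmeasurable) auto
      also have "\<dots> \<le> measure \<mu> (J t - A) + measure \<mu> A" by (rule measure_Un_le) auto
      finally have half_meas: "m t / 2 \<le> measure \<mu> (J t - A)" using a by simp
      have "ennreal (p t * (m t / 2)) \<le> ennreal (p t * measure \<mu> (J t - A))"
        using half_meas decreasing_nonneg[OF p] by (intro ennreal_leI mult_left_mono)
      also have "\<dots> = (\<integral>\<^sup>+s\<in>J t - A. ennreal (p t) \<partial>\<mu>)"
        using Jfin(1) decreasing_nonneg[OF p]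
        by (simp add: nn_integral_cmult_indicator ennreal_mult emeasure_eq_measure2)
      also have "\<dots> \<le> (\<integral>\<^sup>+s. ennreal l * (ennreal \<bar>g s\<bar> * indicator (J t) s) \<partial>\<mu>)"
      proof (rule nn_integral_mono_AE)
        show "AE s in \<mu>. ennreal (p t) * indicator (J t - A) s \<le> ennreal l * (ennreal \<bar>g s\<bar> * indicator (J t) s)"
          using eq
        proof eventually_elim
          case (elim s)
          show ?case
          proof (cases "s \<in> J t - A")
            case True
            then have s: "s \<in> space \<mu>" "s \<le> t" "\<bar>h s\<bar> \<le> l" by (auto simp: init_seg_def A_def)
            have "p t \<le> \<bar>g s * h s\<bar>" using decreasingD[OF p s(1) t s(2)] elim by simp
            also have "\<dots> \<le> l * \<bar>g s\<bar>" using mult_right_mono[OF s(3), of "\<bar>g s\<bar>"] by (simp add: abs_mult mult.commute)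
            finally have "ennreal (p t) \<le> ennreal l * ennreal \<bar>g s\<bar>" using lpos by (simp add: ennreal_leI flip: ennreal_mult)
            then show ?thesis using True by simp
          qed simp
        qed
      qed
      also have "\<dots> = ennreal l * (\<integral>\<^sup>+s\<in>J t. ennreal \<bar>g s\<bar> \<partial>\<mu>)"
        using gd(1) by (intro nn_integral_cmult) auto
      also have "\<dots> = ennreal (l * (?c * m t))"
        using H_eq[OF gd t] lpos by (simp add: ennreal_mult')
      finally have "p t * (m t / 2) \<le> l * (?c * m t)"
        using lpos c by (subst (asm) ennreal_le_iff) auto
      then have "p t * m t \<le> (2 * l * ?c) * m t" by simp
      then show ?thesis using m_pos[OF t] by simp
    qed
    show ?thesis
    proof (rule field_le_epsilon)
      fix e :: real assume e: "0 < e"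
      \<comment> \<open>The bound holds only for levels strictly above 2 w(t), hence the epsilon.
        The summand 1 keeps the denominator positive when \<open>?c\<close> is 0.\<close>
      have "p t \<le> 2 * (2 * w t + e / (2 * (?c + 1))) * ?c" using e c by (intro *) simp
      also have "\<dots> = 4 * w t * ?c + e * (?c / (?c + 1))" using c by (simp add: field_simps)
      also have "\<dots> \<le> 4 * w t * ?c + e * 1" using e c by (intro add_left_mono mult_left_mono) auto
      finally show "p t \<le> 4 * w t * ?c + e" by simp
    qed
  qed
  ultimately show ?thesis using dec by (intro exI[of _ w]) blast
qed

text \<open>Abel summation for Hardy's lemma: the last point \<open>b\<close> has the lowest height
  and the largest segment, so its height splits off as a multiple of one indicator, and the
  increments over z(b) remain on the shorter segments. The \<open>max 0\<close> keeps them in the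
  class of \<open>decreasing\<close> functions.\<close>

lemma step_fun_insert:
  assumes G: "finite G" "insert b G \<subseteq> space \<mu>" "\<And>g. g \<in> G \<Longrightarrow> g < b" and z: "decreasing z"
  shows "step_fun J (insert b G) z t = z b * indicator (J b) t + step_fun J G (\<lambda>s. max 0 (z s - z b)) t"
proof (cases "t \<in> J b")
  case True
  let ?z = "\<lambda>s. max 0 (z s - z b)"
  have fin: "finite (insert b G)" using G by simp
  have zb: "z b \<le> z g" if "g \<in> G" for g using decreasingD[OF z, of g b] G that by (simp add: less_imp_le subset_iff)
  have "step_fun J (insert b G) z t \<le> z b + step_fun J G ?z t"
  proof (rule step_fun_least[OF fin])
    fix g assume g: "g \<in> insert b G" "t \<in> J g"
    show "z g \<le> z b + step_fun J G ?z t"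
    proof (cases "g = b")
      case False
      then show ?thesis using step_fun_upper[of G g t J ?z] g G(1) zb[of g] by auto
    qed (simp add: step_fun_nonneg[OF G(1)])
  qed (simp add: step_fun_nonneg[OF G(1)] decreasing_nonneg[OF z])
  moreover have "step_fun J G ?z t \<le> step_fun J (insert b G) z t - z b"
  proof (rule step_fun_least[OF G(1)])
    show "0 \<le> step_fun J (insert b G) z t - z b" using step_fun_upper[OF fin, of b t J z] True by simp
    fix g assume g: "g \<in> G" "t \<in> J g"
    then show "max 0 (z g - z b) \<le> step_fun J (insert b G) z t - z b"
      using step_fun_upper[OF fin, of g t J z] zb[of g] by auto
  qed
  ultimately show ?thesis using True by simp
next
  case False
  then have no: "t \<notin> J g" if "g \<in> insert b G" for g using G(3) J_mono[of g b] that by (auto simp: less_imp_le)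
  have "step_fun J G' z' t = 0" if "G' \<subseteq> insert b G" for G' z'
  proof (rule antisym)
    have fin: "finite G'" using finite_subset[OF that] G(1) by simp
    show "0 \<le> step_fun J G' z' t" by (rule step_fun_nonneg[OF fin])
    show "step_fun J G' z' t \<le> 0" using no that by (intro step_fun_least[OF fin]) auto
  qed
  then show ?thesis using False by (simp add: subset_insertI)
qed

text \<open>Hardy's lemma for step functions: each split-off term is a nonnegative multiple of an
  integral over the segment up to min b t, where \<open>le\<close> applies. The induction
  generalizes \<open>z\<close>, since the heights change at every split.\<close>

lemma step_fun_integral_mono:
  assumes x: "x \<in> borel_measurable \<mu>" "\<And>s. 0 \<le> x s" and q: "q \<in> borel_measurable \<mu>" "\<And>s. 0 \<le> q s"
    and le: "\<And>s. s \<in> space \<mu> \<Longrightarrow> (\<integral>\<^sup>+u\<in>J s. ennreal (x u) \<partial>\<mu>) \<le> (\<integral>\<^sup>+u\<in>J s. ennreal (q u) \<partial>\<mu>)"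
    and G: "finite G" "G \<subseteq> space \<mu>" and z: "decreasing z" and t: "t \<in> space \<mu>"
  shows "(\<integral>\<^sup>+u\<in>J t. ennreal (step_fun J G z u * x u) \<partial>\<mu>) \<le> (\<integral>\<^sup>+u\<in>J t. ennreal (step_fun J G z u * q u) \<partial>\<mu>)"
  using G z
proof (induction G arbitrary: z rule: finite_linorder_max_induct)
  case empty
  then show ?case by (simp add: step_fun_def)
next
  case (insert b G)
  let ?z = "\<lambda>s. max 0 (z s - z b)"
  have dz: "decreasing ?z" using insert.prems(2) by (fastforce simp: decreasing_def)
  have split: "(\<integral>\<^sup>+u\<in>J t. ennreal (step_fun J (insert b G) z u * v u) \<partial>\<mu>) =
     ennreal (z b) * (\<integral>\<^sup>+u\<in>J (min b t). ennreal (v u) \<partial>\<mu>) + (\<integral>\<^sup>+u\<in>J t. ennreal (step_fun J G ?z u * v u) \<partial>\<mu>)"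
    if v: "v \<in> borel_measurable \<mu>" "\<And>s. 0 \<le> v s" for v
  proof -
    have [measurable]: "step_fun J G ?z \<in> borel_measurable \<mu>"
      by (rule step_fun_measurable) (use insert in auto)
    have "ennreal (step_fun J (insert b G) z u * v u) * indicator (J t) u =
       ennreal (z b) * (ennreal (v u) * indicator (J (min b t)) u) +
       ennreal (step_fun J G ?z u * v u) * indicator (J t) u" for u
    proof -
      have "J (min b t) = J b \<inter> J t" by (auto simp: init_seg_def)
      moreover have "ennreal ((z b + step_fun J G ?z u) * v u) = ennreal (z b) * ennreal (v u) + ennreal (step_fun J G ?z u * v u)"
        using decreasing_nonneg[OF insert.prems(2), of b] v(2)[of u] step_fun_nonneg[OF insert.hyps(1), of J ?z u]
        by (simp add: distrib_right ennreal_plus ennreal_mult)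
      moreover have "step_fun J (insert b G) z u = z b * indicator (J b) u + step_fun J G ?z u"
        using insert.hyps insert.prems by (intro step_fun_insert) auto
      ultimately show ?thesis by (cases "u \<in> J b"; cases "u \<in> J t") simp_all
    qed
    then show ?thesis using v by (simp add: nn_integral_add nn_integral_cmult)
  qed
  have "min b t \<in> space \<mu>" using insert.prems t by (auto simp: min_def)
  then show ?case unfolding split[OF x] split[OF q]
    using insert.IH[OF _ dz] insert.prems le by (intro add_mono mult_left_mono) auto
qed

text \<open>Fatou's lemma passes from step functions to \<open>w\<close> on the left; on the right
  the step functions simply stay below \<open>w\<close>.\<close>

lemma weighted_integral_mono:
  assumes x: "x \<in> borel_measurable \<mu>" "\<And>s. 0 \<le> x s" and q: "q \<in> borel_measurable \<mu>" "\<And>s. 0 \<le> q s"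
    and le: "\<And>s. s \<in> space \<mu> \<Longrightarrow> (\<integral>\<^sup>+u\<in>J s. ennreal (x u) \<partial>\<mu>) \<le> (\<integral>\<^sup>+u\<in>J s. ennreal (q u) \<partial>\<mu>)"
    and w: "decreasing w" and t: "t \<in> space \<mu>"
  shows "(\<integral>\<^sup>+u\<in>J t. ennreal (w u * x u) \<partial>\<mu>) \<le> (\<integral>\<^sup>+u\<in>J t. ennreal (w u * q u) \<partial>\<mu>)"
proof -
  let ?f = "\<lambda>n u. ennreal (step_fun J (grid n) w u * x u) * indicator (J t) u"
  have [measurable]: "step_fun J (grid n) w \<in> borel_measurable \<mu>" for n
    by (rule step_fun_measurable) (auto simp: grid)
  note x(1)[measurable]
  have "AE u in \<mu>. ennreal (w u * x u) * indicator (J t) u = liminf (\<lambda>n. ?f n u)"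
    using step_grid_tendsto[OF w]
  proof eventually_elim
    case (elim u)
    have "(\<lambda>n. ennreal (step_fun J (grid n) w u * x u)) \<longlonglongrightarrow> ennreal (w u * x u)"
      using elim by (intro tendsto_ennrealI tendsto_mult_right)
    then have "(\<lambda>n. ?f n u) \<longlonglongrightarrow> ennreal (w u * x u) * indicator (J t) u"
      by (cases "u \<in> J t") auto
    then show ?case by (simp add: lim_imp_Liminf)
  qed
  then have "(\<integral>\<^sup>+u\<in>J t. ennreal (w u * x u) \<partial>\<mu>) = (\<integral>\<^sup>+u. liminf (\<lambda>n. ?f n u) \<partial>\<mu>)"
    by (rule nn_integral_cong_AE)
  also have "\<dots> \<le> liminf (\<lambda>n. \<integral>\<^sup>+u. ?f n u \<partial>\<mu>)"
    by (intro nn_integral_liminf) measurable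
  also have "\<dots> \<le> liminf (\<lambda>n. (\<integral>\<^sup>+u\<in>J t. ennreal (w u * q u) \<partial>\<mu>))"
  proof (intro Liminf_mono always_eventually allI)
    fix n
    have "(\<integral>\<^sup>+u. ?f n u \<partial>\<mu>) \<le> (\<integral>\<^sup>+u\<in>J t. ennreal (step_fun J (grid n) w u * q u) \<partial>\<mu>)"
      by (rule step_fun_integral_mono[OF x q le grid(1,2) w t])
    also have "\<dots> \<le> (\<integral>\<^sup>+u\<in>J t. ennreal (w u * q u) \<partial>\<mu>)"
      using step_fun_le[OF grid(1,2) w] q(2)
      by (intro nn_integral_mono mult_right_mono ennreal_leI) auto
    finally show "(\<integral>\<^sup>+u. ?f n u \<partial>\<mu>) \<le> (\<integral>\<^sup>+u\<in>J t. ennreal (w u * q u) \<partial>\<mu>)" .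
  qed
  also have "\<dots> = (\<integral>\<^sup>+u\<in>J t. ennreal (w u * q u) \<partial>\<mu>)" by (simp add: Liminf_const)
  finally show ?thesis .
qed

text \<open>The block to the right of \<open>t\<close> has positive measure. Since integrals over
  initial segments increase, an a.e. bound at a later point controls the integral at
  \<open>t\<close> itself.\<close>

lemma AE_cofinal:
  assumes "AE t in \<mu>. P t" and t: "t \<in> space \<mu>"
  shows "\<exists>u\<in>space \<mu>. t \<le> u \<and> P u"
proof (rule ccontr)
  assume no: "\<not> ?thesis"
  obtain t' where t': "emeasure \<mu> (J t' - J t) = emeasure \<mu> (J t)" using less_space[OF t] by blast
  have "AE u in \<mu>. u \<notin> J t' - J t"
    using assms(1) AE_space
  proof eventually_elim
    case (elim u)
    then have "\<not> t \<le> u" using no by blast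
    then show ?case by (auto simp: init_seg_def)
  qed
  then have "emeasure \<mu> (J t' - J t) = 0"
    by (subst (asm) AE_iff_measurable[OF sets.Diff[OF J_sets[of t'] J_sets[of t]]]) (auto simp: init_seg_def)
  then show False using init_seg_pos[OF t] t' by simp
qed

text \<open>Countably many segments with end points in \<open>D\<close> cover almost everything:
  this is \<open>D_dense\<close> applied to the constant function 0.\<close>

lemma AE_init_segs:
  assumes "\<And>g. g \<in> D \<Longrightarrow> AE t in \<mu>. t \<in> J g \<longrightarrow> P t"
  shows "AE t in \<mu>. P t"
proof -
  have "AE t in \<mu>. \<forall>g\<in>D. t \<in> J g \<longrightarrow> P t" using assms by (subst AE_ball_countable[OF D(1)]) blast
  moreover have "AE t in \<mu>. \<forall>e>0. \<exists>g\<in>D. t \<le> g \<and> (0::real) - e < 0" by (rule D_dense) simp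
  ultimately show ?thesis using AE_space
  proof eventually_elim
    case (elim t)
    then obtain g where "g \<in> D" "t \<le> g" by (meson zero_less_one)
    with elim show ?case by (auto simp: init_seg_def)
  qed
qed

lemma H_eq_0_imp:
  assumes x: "x \<in> borel_measurable \<mu>" "\<And>s. 0 \<le> x s" "Hd x" and zero: "AE t in \<mu>. H x t = 0"
  shows "AE t in \<mu>. x t = 0"
proof (rule AE_init_segs)
  fix g assume "g \<in> D"
  then have g: "g \<in> space \<mu>" using D by blast
  obtain u where u: "u \<in> space \<mu>" "g \<le> u" "H x u = 0" using AE_cofinal[OF zero g] by blast
  have "H x g * m g \<le> 0" using H_mono_local[OF x g u(1,2)] u(3) by simp
  then have "(\<integral>\<^sup>+s\<in>J g. ennreal (x s) \<partial>\<mu>) = 0" using H_eq[OF x g] by (simp add: ennreal_neg)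
  then have "AE s in \<mu>. ennreal (x s) * indicator (J g) s = 0"
    using x(1) by (subst (asm) nn_integral_0_iff_AE) auto
  then show "AE s in \<mu>. s \<in> J g \<longrightarrow> x s = 0"
    using x(2) by eventually_elim (auto simp: indicator_def ennreal_eq_0_iff intro: antisym[OF _ x(2)])
qed

section \<open>Cesaro spaces as ideal spaces with the domination property\<close>

lemma ces_mem:
  "f \<in> carr (ces E) \<longleftrightarrow> f \<in> borel_measurable \<mu> \<and> Hd (\<lambda>s. \<bar>f s\<bar>) \<and> H (\<lambda>s. \<bar>f s\<bar>) \<in> carr E"
  and ces_nrm: "nrm (ces E) f = nrm E (H (\<lambda>s. \<bar>f s\<bar>))"
  by (simp_all add: ces_def)

lemma ces_memD:
  assumes "f \<in> carr (ces E)"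
  shows "(\<lambda>s. \<bar>f s\<bar>) \<in> borel_measurable \<mu>" "\<And>s. 0 \<le> \<bar>f s\<bar>" "Hd (\<lambda>s. \<bar>f s\<bar>)"
    "H (\<lambda>s. \<bar>f s\<bar>) \<in> carr E"
  using assms by (auto simp: ces_mem)

lemma ces_bound:
  assumes E: "admissible E" and f: "f \<in> borel_measurable \<mu>" "Hd (\<lambda>s. \<bar>f s\<bar>)"
    and v: "v \<in> carr E" "0 \<le> c" "AE t in \<mu>. H (\<lambda>s. \<bar>f s\<bar>) t \<le> c * \<bar>v t\<bar>"
  shows "f \<in> carr (ces E)" "nrm (ces E) f \<le> c * nrm E v"
proof -
  interpret ideal_fspace \<mu> E by (rule admissible_ideal[OF E])
  have f': "(\<lambda>s. \<bar>f s\<bar>) \<in> borel_measurable \<mu>" using f by simp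
  have "AE t in \<mu>. \<bar>H (\<lambda>s. \<bar>f s\<bar>) t\<bar> \<le> c * \<bar>v t\<bar>"
    using v(3) AE_space by eventually_elim (use H_nonneg[OF f' _ f(2)] in auto)
  from scaled_mem[OF v(1) H_measurable[OF f' _ f(2)] this v(2)] f
  show "f \<in> carr (ces E)" "nrm (ces E) f \<le> c * nrm E v" by (auto simp: ces_mem ces_nrm)
qed

lemma ces_scale:
  assumes E: "admissible E" and f: "f \<in> carr (ces E)"
  shows "(\<lambda>t. a * f t) \<in> carr (ces E)" "nrm (ces E) (\<lambda>t. a * f t) = \<bar>a\<bar> * nrm (ces E) f"
proof -
  interpret ideal_fspace \<mu> E by (rule admissible_ideal[OF E])
  note fd = ces_memD[OF f]
  have eq: "(\<lambda>s. \<bar>a * f s\<bar>) = (\<lambda>s. \<bar>a\<bar> * \<bar>f s\<bar>)" by (simp add: abs_mult)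
  note sc = H_scale[OF fd(1-3) abs_ge_zero[of a]]
  have m: "(\<lambda>s. \<bar>a\<bar> * \<bar>f s\<bar>) \<in> borel_measurable \<mu>" "\<And>s. 0 \<le> \<bar>a\<bar> * \<bar>f s\<bar>" using fd(1) by auto
  have "AE t in \<mu>. \<bar>H (\<lambda>s. \<bar>a\<bar> * \<bar>f s\<bar>) t\<bar> = \<bar>\<bar>a\<bar> * H (\<lambda>s. \<bar>f s\<bar>) t\<bar>"
    using sc(2) by (intro AE_I2) simp
  note c = cong_mem[OF scale_mem[OF fd(4)] H_measurable[OF m sc(1)] this]
  have "f \<in> borel_measurable \<mu>" using f by (simp add: ces_mem)
  then show "(\<lambda>t. a * f t) \<in> carr (ces E)" "nrm (ces E) (\<lambda>t. a * f t) = \<bar>a\<bar> * nrm (ces E) f"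
    using c sc(1) nrm_scale[OF fd(4), of "\<bar>a\<bar>"] by (auto simp: ces_mem ces_nrm eq)
qed

text \<open>Domination in \<open>E\<close> gives one \<open>s\<close> with H|Y n| \<le> 2^n |s|. The
  series of |Y n| / 4^n then has Hardy average at most 2 |s|, because one factor 2^n is left to make
  it converge.\<close>

lemma ces_dominated:
  assumes E: "admissible E" and Y: "\<And>n. Y n \<in> carr (ces E)" "\<And>n. nrm (ces E) (Y n) \<le> 1"
  shows "\<exists>y\<in>carr (ces E). \<forall>n. AE t in \<mu>. \<bar>Y n t\<bar> \<le> 4 ^ n * \<bar>y t\<bar>"
proof -
  have Yd: "(\<lambda>s. \<bar>Y n s\<bar>) \<in> borel_measurable \<mu>" "\<And>s. 0 \<le> \<bar>Y n s\<bar>" "Hd (\<lambda>s. \<bar>Y n s\<bar>)"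
    "H (\<lambda>s. \<bar>Y n s\<bar>) \<in> carr E" for n using ces_memD[OF Y(1)] by blast+
  have [measurable]: "Y n \<in> borel_measurable \<mu>" for n using Y(1) by (simp add: ces_mem)
  obtain s where s: "s \<in> carr E" "\<And>n. AE t in \<mu>. \<bar>H (\<lambda>s. \<bar>Y n s\<bar>) t\<bar> \<le> 2 ^ n * \<bar>s t\<bar>"
    using banach_ideal_dominated[OF admissible_banach[OF E], of "\<lambda>n. H (\<lambda>s. \<bar>Y n s\<bar>)"] Yd(4) Y(2)
    by (auto simp: ces_nrm)
  \<comment> \<open>Summation in \<open>ennreal\<close> lets sum and integral be exchanged before
    convergence is known.\<close>
  define Z where "Z t = (\<Sum>n. ennreal (\<bar>Y n t\<bar> / 4 ^ n))" for t
  have Zm [measurable]: "Z \<in> borel_measurable \<mu>" unfolding Z_def by measurable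
  have ZI: "(\<integral>\<^sup>+u\<in>J t. Z u \<partial>\<mu>) = (\<Sum>n. ennreal (H (\<lambda>s. \<bar>Y n s\<bar>) t * m t / 4 ^ n))" if t: "t \<in> space \<mu>" for t
  proof -
    have "(\<integral>\<^sup>+u\<in>J t. Z u \<partial>\<mu>) = (\<integral>\<^sup>+u. (\<Sum>n. ennreal (1 / 4 ^ n) * (ennreal \<bar>Y n u\<bar> * indicator (J t) u)) \<partial>\<mu>)"
      unfolding Z_def by (intro nn_integral_cong) (simp add: indicator_def flip: ennreal_mult)
    also have "\<dots> = (\<Sum>n. ennreal (1 / 4 ^ n) * (\<integral>\<^sup>+u\<in>J t. ennreal \<bar>Y n u\<bar> \<partial>\<mu>))"
      by (subst nn_integral_suminf) (auto simp: nn_integral_cmult)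
    also have "\<dots> = (\<Sum>n. ennreal (H (\<lambda>s. \<bar>Y n s\<bar>) t * m t / 4 ^ n))"
      unfolding H_eq[OF Yd(1-3) t] by (simp flip: ennreal_mult')
    finally show ?thesis .
  qed
  have bound: "AE t in \<mu>. (\<integral>\<^sup>+u\<in>J t. Z u \<partial>\<mu>) \<le> ennreal (2 * \<bar>s t\<bar> * m t)"
  proof -
    have "AE t in \<mu>. \<forall>n. \<bar>H (\<lambda>s. \<bar>Y n s\<bar>) t\<bar> \<le> 2 ^ n * \<bar>s t\<bar>" using s(2) by (simp add: AE_all_countable)
    then show ?thesis using AE_space
    proof eventually_elim
      case (elim t)
      have "(\<integral>\<^sup>+u\<in>J t. Z u \<partial>\<mu>) \<le> (\<Sum>n. ennreal ((\<bar>s t\<bar> * m t) * (1 / 2) ^ n))"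
        unfolding ZI[OF elim(2)]
      proof (intro suminf_le ennreal_leI)
        fix n
        have "H (\<lambda>s. \<bar>Y n s\<bar>) t * m t / 4 ^ n \<le> 2 ^ n * \<bar>s t\<bar> * m t / 4 ^ n"
          using elim(1) by (intro divide_right_mono mult_right_mono) (auto intro: order_trans[OF abs_ge_self])
        also have "\<dots> = (\<bar>s t\<bar> * m t) * (2 ^ n / 4 ^ n)" by simp
        also have "(2::real) ^ n / 4 ^ n = (1 / 2) ^ n" by (simp flip: power_divide)
        finally show "H (\<lambda>s. \<bar>Y n s\<bar>) t * m t / 4 ^ n \<le> (\<bar>s t\<bar> * m t) * (1 / 2) ^ n" .
      qed auto
      also have "\<dots> = ennreal ((\<bar>s t\<bar> * m t) * 2)"
        by (intro suminf_ennreal_eq sums_mult) (use geometric_sums[of "1/2::real"] in auto)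
      finally show ?case by (simp add: ac_simps)
    qed
  qed
  \<comment> \<open>\<open>bound\<close> holds only a.e., but \<open>Hd\<close> requires finiteness
    at every \<open>t\<close>; a later point where the bound holds provides it.\<close>
  have fin: "(\<integral>\<^sup>+u\<in>J t. Z u \<partial>\<mu>) < \<infinity>" if t: "t \<in> space \<mu>" for t
  proof -
    obtain u where u: "u \<in> space \<mu>" "t \<le> u" "(\<integral>\<^sup>+v\<in>J u. Z v \<partial>\<mu>) \<le> ennreal (2 * \<bar>s u\<bar> * m u)"
      using AE_cofinal[OF bound t] by blast
    have "(\<integral>\<^sup>+v\<in>J t. Z v \<partial>\<mu>) \<le> (\<integral>\<^sup>+v\<in>J u. Z v \<partial>\<mu>)"
      using J_mono[OF u(2)] by (intro nn_integral_mono) (auto simp: indicator_def)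
    also note u(3)
    also have "ennreal (2 * \<bar>s u\<bar> * m u) < \<infinity>" by simp
    finally show ?thesis .
  qed
  have Zfin: "AE t in \<mu>. Z t < \<infinity>"
  proof (rule AE_init_segs)
    fix g assume "g \<in> D"
    then have "g \<in> space \<mu>" using D by blast
    from fin[OF this] have "AE t in \<mu>. Z t * indicator (J g) t \<noteq> \<infinity>"
      by (intro nn_integral_noteq_infinite) auto
    then show "AE t in \<mu>. t \<in> J g \<longrightarrow> Z t < \<infinity>"
      by eventually_elim (auto simp: less_top)
  qed
  \<comment> \<open>\<open>enn2real\<close> sends infinity to 0, which happens only on a null set by
    \<open>Zfin\<close>; so \<open>y\<close> stays below \<open>Z\<close> and still dominates
    a.e.\<close>
  define y where "y t = enn2real (Z t)" for t
  have y: "y \<in> borel_measurable \<mu>" "\<And>t. 0 \<le> y t" by (auto simp: y_def[abs_def])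
  have yI: "(\<integral>\<^sup>+u\<in>J t. ennreal (y u) \<partial>\<mu>) \<le> (\<integral>\<^sup>+u\<in>J t. Z u \<partial>\<mu>)" for t
    by (intro nn_integral_mono mult_right_mono) (auto simp: y_def ennreal_enn2real_if)
  have yd: "Hd y" unfolding Hd_iff[OF y] using yI fin le_less_trans by blast
  have "AE t in \<mu>. H (\<lambda>s. \<bar>y s\<bar>) t \<le> 2 * \<bar>s t\<bar>"
    using bound AE_space
  proof eventually_elim
    case (elim t)
    have "ennreal (H y t * m t) \<le> ennreal (2 * \<bar>s t\<bar> * m t)"
      using yI[of t] elim(1) unfolding H_eq[OF y yd elim(2)] by (rule order_trans)
    then have "H y t * m t \<le> 2 * \<bar>s t\<bar> * m t" by (subst (asm) ennreal_le_iff) auto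
    then show ?case using m_pos[OF elim(2)] y(2) by simp
  qed
  then have "y \<in> carr (ces E)" using y yd s(1) by (intro ces_bound(1)[OF E, of y s 2]) auto
  moreover have "AE t in \<mu>. \<bar>Y n t\<bar> \<le> 4 ^ n * \<bar>y t\<bar>" for n
    using Zfin
  proof eventually_elim
    case (elim t)
    have "ennreal (\<bar>Y n t\<bar> / 4 ^ n) \<le> Z t"
    proof -
      have "(\<Sum>k\<in>{n}. ennreal (\<bar>Y k t\<bar> / 4 ^ k)) \<le> (\<Sum>k. ennreal (\<bar>Y k t\<bar> / 4 ^ k))"
        by (rule sum_le_suminf) auto
      then show ?thesis by (simp add: Z_def)
    qed
    then have "enn2real (ennreal (\<bar>Y n t\<bar> / 4 ^ n)) \<le> y t"
      unfolding y_def using elim by (intro enn2real_mono) auto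
    then have "\<bar>Y n t\<bar> / 4 ^ n \<le> y t" by (subst (asm) enn2real_ennreal) auto
    then show ?case using y(2)[of t] by (simp add: field_simps)
  qed
  ultimately show ?thesis by blast
qed

lemma ces_ideal:
  assumes E: "admissible E"
  shows "ideal_fspace \<mu> (ces E)"
proof
  interpret ideal_fspace \<mu> E by (rule admissible_ideal[OF E])
  fix f assume f: "f \<in> carr (ces E)"
  note fd = ces_memD[OF f]
  show "f \<in> borel_measurable \<mu>" using f by (simp add: ces_mem)
  show "0 \<le> nrm (ces E) f" unfolding ces_nrm by (rule nrm_nonneg[OF fd(4)])
  show "(\<lambda>t. a * f t) \<in> carr (ces E)" "nrm (ces E) (\<lambda>t. a * f t) = \<bar>a\<bar> * nrm (ces E) f" for a
    using ces_scale[OF E f] .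
  show "nrm (ces E) f = 0 \<longleftrightarrow> (AE t in \<mu>. f t = 0)"
    unfolding ces_nrm nrm_zero_iff[OF fd(4)]
  proof
    assume "AE t in \<mu>. H (\<lambda>s. \<bar>f s\<bar>) t = 0"
    from H_eq_0_imp[OF fd(1-3) this] show "AE t in \<mu>. f t = 0" by simp
  next
    assume z: "AE t in \<mu>. f t = 0"
    show "AE t in \<mu>. H (\<lambda>s. \<bar>f s\<bar>) t = 0"
    proof (rule AE_I2)
      fix t assume t: "t \<in> space \<mu>"
      have "(\<integral>\<^sup>+s\<in>J t. ennreal \<bar>f s\<bar> \<partial>\<mu>) = (\<integral>\<^sup>+s. 0 \<partial>\<mu>)"
        using z by (intro nn_integral_cong_AE) auto
      then have "ennreal (H (\<lambda>s. \<bar>f s\<bar>) t * m t) = 0" unfolding H_eq[OF fd(1-3) t] by simp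
      then have "H (\<lambda>s. \<bar>f s\<bar>) t * m t \<le> 0" by (simp only: ennreal_eq_0_iff)
      then show "H (\<lambda>s. \<bar>f s\<bar>) t = 0"
        using m_pos[OF t] H_nonneg[OF fd(1-3) t] by (simp add: mult_le_0_iff)
    qed
  qed
  show "x \<in> carr (ces E)" "nrm (ces E) x \<le> nrm (ces E) f"
    if x: "x \<in> borel_measurable \<mu>" "AE t in \<mu>. \<bar>x t\<bar> \<le> \<bar>f t\<bar>" for x
  proof -
    have xm: "(\<lambda>s. \<bar>x s\<bar>) \<in> borel_measurable \<mu>" "\<And>s. 0 \<le> \<bar>x s\<bar>" using x by auto
    note mono = H_mono[OF xm fd(1-3) x(2)]
    have "AE t in \<mu>. H (\<lambda>s. \<bar>x s\<bar>) t \<le> 1 * \<bar>H (\<lambda>s. \<bar>f s\<bar>) t\<bar>"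
      using mono(2) by (intro AE_I2) fastforce
    from ces_bound[OF E x(1) mono(1) fd(4) _ this]
    show "x \<in> carr (ces E)" "nrm (ces E) x \<le> nrm (ces E) f" by (auto simp: ces_nrm)
  qed
next
  fix Y :: "nat \<Rightarrow> 'a \<Rightarrow> real"
  assume "\<And>n. Y n \<in> carr (ces E)" "\<And>n. nrm (ces E) (Y n) \<le> 1"
  then show "\<exists>y\<in>carr (ces E). \<forall>n. AE t in \<mu>. \<bar>Y n t\<bar> \<le> 4 ^ n * \<bar>y t\<bar>" by (rule ces_dominated[OF E])
qed

section \<open>The weight as a multiplier and the quotient by it\<close>

lemma weight_multiplies_ces:
  assumes E: "admissible E" and F: "admissible F" and w: "decreasing w"
    and C: "0 \<le> C" "\<forall>x\<in>carr F. nrm F (H x) \<le> C * nrm F x" and B: "0 \<le> B"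
    and wy: "\<And>y. y \<in> carr E \<Longrightarrow> decreasing y \<Longrightarrow>
      (\<lambda>t. w t * y t) \<in> carr F \<and> nrm F (\<lambda>t. w t * y t) \<le> B * nrm E y"
    and y: "y \<in> carr (ces E)"
  shows "(\<lambda>t. w t * y t) \<in> carr (ces F) \<and> nrm (ces F) (\<lambda>t. w t * y t) \<le> 4 * C * B * nrm (ces E) y"
proof -
  note yd = ces_memD[OF y]
  obtain q where q: "decreasing q" "q \<in> carr E" "nrm E q \<le> 4 * nrm (ces E) y"
    "\<forall>t\<in>space \<mu>. H (\<lambda>s. \<bar>y s\<bar>) t \<le> q t"
    using decreasing_majorant[OF E yd] unfolding ces_nrm by blast
  have qd: "q \<in> borel_measurable \<mu>" "\<And>s. 0 \<le> q s" "Hd q"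
    using decreasing_measurable decreasing_nonneg q admissible_H[OF E] by blast+
  note wq = wy[OF q(2,1)]
  have wqd: "(\<lambda>s. w s * q s) \<in> borel_measurable \<mu>" "\<And>s. 0 \<le> w s * q s" "Hd (\<lambda>s. w s * q s)"
    using decreasing_mult[OF w q(1)] decreasing_measurable decreasing_nonneg wq admissible_H[OF F] by blast+
  \<comment> \<open>Although |y| need not lie below \<open>q\<close>, its averages do, and q \<le> H
    q because \<open>q\<close> decreases.\<close>
  have le: "(\<integral>\<^sup>+u\<in>J s. ennreal \<bar>y u\<bar> \<partial>\<mu>) \<le> (\<integral>\<^sup>+u\<in>J s. ennreal (q u) \<partial>\<mu>)" if s: "s \<in> space \<mu>" for s
    unfolding H_eq[OF yd(1-3) s] H_eq[OF qd s]
    using q(4) s H_ge_decreasing[OF q(1) qd(3) s] m_pos[OF s]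
    by (intro ennreal_leI mult_right_mono) fastforce+
  have wle: "(\<integral>\<^sup>+u\<in>J t. ennreal (w u * \<bar>y u\<bar>) \<partial>\<mu>) \<le> (\<integral>\<^sup>+u\<in>J t. ennreal (w u * q u) \<partial>\<mu>)"
    if "t \<in> space \<mu>" for t
    by (rule weighted_integral_mono[OF yd(1,2) qd(1,2) le w that])
  have abs: "(\<lambda>t. \<bar>w t * y t\<bar>) = (\<lambda>t. w t * \<bar>y t\<bar>)"
    using decreasing_nonneg[OF w] by (simp add: abs_mult)
  have x: "(\<lambda>t. w t * \<bar>y t\<bar>) \<in> borel_measurable \<mu>" "\<And>t. 0 \<le> w t * \<bar>y t\<bar>"
    using decreasing_measurable[OF w] yd(1) decreasing_nonneg[OF w] by auto
  have Hdx: "Hd (\<lambda>t. w t * \<bar>y t\<bar>)"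
    unfolding Hd_iff[OF x] using wle wqd(3) Hd_iff[OF wqd(1,2)] le_less_trans by blast
  have "AE t in \<mu>. H (\<lambda>t. \<bar>w t * y t\<bar>) t \<le> 1 * \<bar>H (\<lambda>t. w t * q t) t\<bar>"
  proof (rule AE_I2)
    fix t assume t: "t \<in> space \<mu>"
    have "ennreal (H (\<lambda>t. w t * \<bar>y t\<bar>) t * m t) \<le> ennreal (H (\<lambda>t. w t * q t) t * m t)"
      using wle[OF t] unfolding H_eq[OF x Hdx t] H_eq[OF wqd t] .
    then have "H (\<lambda>t. w t * \<bar>y t\<bar>) t * m t \<le> H (\<lambda>t. w t * q t) t * m t"
      using H_nonneg[OF wqd t] by (subst (asm) ennreal_le_iff) auto
    then show "H (\<lambda>t. \<bar>w t * y t\<bar>) t \<le> 1 * \<bar>H (\<lambda>t. w t * q t) t\<bar>"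
      unfolding abs using m_pos[OF t] by simp
  qed
  moreover have "(\<lambda>t. w t * y t) \<in> borel_measurable \<mu>"
    using decreasing_measurable[OF w] y by (auto simp: ces_mem)
  moreover have "Hd (\<lambda>t. \<bar>w t * y t\<bar>)" unfolding abs by (rule Hdx)
  moreover have "H (\<lambda>t. w t * q t) \<in> carr F" using admissible_H(2)[OF F] wq by blast
  ultimately have *: "(\<lambda>t. w t * y t) \<in> carr (ces F)"
     "nrm (ces F) (\<lambda>t. w t * y t) \<le> nrm F (H (\<lambda>t. w t * q t))"
    using ces_bound[OF F, of "\<lambda>t. w t * y t" "H (\<lambda>t. w t * q t)" 1] by auto
  note *(2)
  also have "nrm F (H (\<lambda>t. w t * q t)) \<le> C * nrm F (\<lambda>t. w t * q t)" using C(2) wq by blast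
  also have "\<dots> \<le> C * (B * (4 * nrm (ces E) y))"
    using wq q(3) C(1) B by (meson mult_left_mono order_trans)
  finally show ?thesis using *(1) by (simp add: mult_ac)
qed

lemma quotient_in_ces:
  assumes E: "admissible E" and w: "decreasing w" and pos: "\<And>t. t \<in> space \<mu> \<Longrightarrow> 0 < w t"
    and f: "f \<in> borel_measurable \<mu>" "Hd (\<lambda>s. \<bar>f s\<bar>)" and v: "v \<in> carr E" "0 \<le> c"
    and le: "\<And>t. t \<in> space \<mu> \<Longrightarrow> H (\<lambda>s. \<bar>f s\<bar>) t \<le> c * w t * v t"
  shows "(\<lambda>t. f t / w t) \<in> carr (ces E)" "nrm (ces E) (\<lambda>t. f t / w t) \<le> c * nrm E v"
proof -
  have fd: "(\<lambda>s. \<bar>f s\<bar>) \<in> borel_measurable \<mu>" "\<And>s. 0 \<le> \<bar>f s\<bar>" using f by auto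
  let ?x = "\<lambda>t. \<bar>f t / w t\<bar>"
  have x: "(\<lambda>t. f t / w t) \<in> borel_measurable \<mu>" "?x \<in> borel_measurable \<mu>" "\<And>t. 0 \<le> ?x t"
    using f decreasing_measurable[OF w] by auto
  have I: "(\<integral>\<^sup>+u\<in>J t. ennreal (?x u) \<partial>\<mu>) \<le> ennreal (H (\<lambda>s. \<bar>f s\<bar>) t / w t * m t)" if t: "t \<in> space \<mu>" for t
  proof -
    have "(\<integral>\<^sup>+u\<in>J t. ennreal (?x u) \<partial>\<mu>) \<le> (\<integral>\<^sup>+u. ennreal (1 / w t) * (ennreal \<bar>f u\<bar> * indicator (J t) u) \<partial>\<mu>)"
    proof (rule nn_integral_mono)
      fix u assume "u \<in> space \<mu>"
      show "ennreal (?x u) * indicator (J t) u \<le> ennreal (1 / w t) * (ennreal \<bar>f u\<bar> * indicator (J t) u)"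
      proof (cases "u \<in> J t")
        case True
        then have "w t \<le> w u" "0 < w u" using decreasingD[OF w _ t] pos by (auto simp: init_seg_def)
        then have "?x u \<le> 1 / w t * \<bar>f u\<bar>" using pos[OF t] by (simp add: abs_divide frac_le)
        then have "ennreal (?x u) \<le> ennreal (1 / w t) * ennreal \<bar>f u\<bar>" using pos[OF t]
          by (simp add: ennreal_leI flip: ennreal_mult)
        then show ?thesis using True by simp
      qed simp
    qed
    also have "\<dots> = ennreal (1 / w t) * ennreal (H (\<lambda>s. \<bar>f s\<bar>) t * m t)"
      using fd(1) H_eq[OF fd f(2) t] by (simp add: nn_integral_cmult)
    also have "\<dots> = ennreal (H (\<lambda>s. \<bar>f s\<bar>) t / w t * m t)" using pos[OF t] by (simp flip: ennreal_mult')
    finally show ?thesis .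
  qed
  have Hdx: "Hd ?x" unfolding Hd_iff[OF x(2,3)]
  proof
    fix t assume "t \<in> space \<mu>"
    from le_less_trans[OF I[OF this]] show "(\<integral>\<^sup>+u\<in>J t. ennreal (?x u) \<partial>\<mu>) < \<infinity>" by simp
  qed
  have "AE t in \<mu>. H ?x t \<le> c * \<bar>v t\<bar>"
  proof (rule AE_I2)
    fix t assume t: "t \<in> space \<mu>"
    have "H ?x t * m t \<le> H (\<lambda>s. \<bar>f s\<bar>) t / w t * m t"
      using I[OF t] pos[OF t] H_nonneg[OF fd f(2) t] unfolding H_eq[OF x(2,3) Hdx t]
      by (subst (asm) ennreal_le_iff) auto
    then have "H ?x t \<le> H (\<lambda>s. \<bar>f s\<bar>) t / w t" using m_pos[OF t] by (rule mult_right_le_imp_le)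
    also have "\<dots> \<le> c * v t" using le[OF t] pos[OF t] by (simp add: pos_divide_le_eq mult_ac)
    also have "\<dots> \<le> c * \<bar>v t\<bar>" using v(2) by (intro mult_left_mono) auto
    finally show "H ?x t \<le> c * \<bar>v t\<bar>" .
  qed
  from ces_bound[OF E x(1) Hdx v this]
  show "(\<lambda>t. f t / w t) \<in> carr (ces E)" "nrm (ces E) (\<lambda>t. f t / w t) \<le> c * nrm E v" .
qed

theorem ces_factorization:
  assumes E: "admissible E" and F: "admissible F" and fac: "same_space F (product_space \<mu> E (multipliers \<mu> E F))"
  shows "same_space (ces F) (product_space \<mu> (ces E) (multipliers \<mu> (ces E) (ces F)))"
proof -
  interpret E: ideal_fspace \<mu> E by (rule admissible_ideal[OF E])
  interpret F: ideal_fspace \<mu> F by (rule admissible_ideal[OF F])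
  interpret CE: ideal_fspace \<mu> "ces E" by (rule ces_ideal[OF E])
  interpret CF: ideal_fspace \<mu> "ces F" by (rule ces_ideal[OF F])
  let ?M = "multipliers \<mu> E F"
  obtain t0 where t0: "t0 \<in> space \<mu>" using D by blast
  let ?e = "indicator (J t0) :: 'a \<Rightarrow> real"
  have eE: "?e \<in> carr E" "nrm E ?e \<noteq> 0"
    using indicator_mem(1)[OF E t0 J_sets refl] indicator_nrm_pos[OF E t0] by auto
  have e: "?e \<in> carr (ces E)" using eE admissible_H[OF E eE(1)] by (auto simp: ces_mem)
  have e0: "nrm (ces E) ?e \<noteq> 0" using CE.nrm_zero_iff[OF e] E.nrm_zero_iff[OF eE(1)] eE(2) by simp
  have zeroE: "(\<lambda>t. 0) \<in> carr (ces E)" using CE.scale_mem[OF e, of 0] by simp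
  have "?e \<in> carr F" using indicator_mem(1)[OF F t0 J_sets refl] .
  then have "?e \<in> carr (ces F)" using admissible_H[OF F] by (auto simp: ces_mem)
  from CF.scale_mem[OF this, of 0] have zeroF: "(\<lambda>t. 0) \<in> carr (ces F)" by simp
  obtain CE where CE: "0 \<le> CE" "\<forall>x\<in>carr E. nrm E (H x) \<le> CE * nrm E x" using admissible_H_bound[OF E] by blast
  obtain CF where CF: "0 \<le> CF" "\<forall>x\<in>carr F. nrm F (H x) \<le> CF * nrm F x" using admissible_H_bound[OF F] by blast
  obtain C where C: "0 < C" "carr F = carr (product_space \<mu> E ?M)"
      "\<And>x. x \<in> carr F \<Longrightarrow> nrm (product_space \<mu> E ?M) x \<le> C * nrm F x"
    using fac unfolding same_space_def by blast
  \<comment> \<open>In the constant, f/w contributes 4 CE and multiplication by \<open>w\<close>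
    contributes 4 CF B with B = 2 CF times the norm of \<open>h\<close>. In 4 C + 1 the 4 is that of
    the majorant \<open>p\<close> and the 1 is the slack in choosing \<open>g\<close> and
    \<open>h\<close>.\<close>
  show ?thesis
  proof (rule factorization_criterion[OF ces_ideal[OF E] ces_ideal[OF F] e e0 zeroE zeroF,
      where C = "32 * CE * CF\<^sup>2 * (4 * C + 1)"])
    fix f assume f: "f \<in> carr (ces F)" and "nrm (ces F) f \<noteq> 0"
    then have fpos: "0 < nrm (ces F) f" using CF.nrm_nonneg[OF f] by simp
    note fd = ces_memD[OF f]
    obtain p where p: "decreasing p" "p \<in> carr F" "nrm F p \<le> 4 * nrm (ces F) f"
        "\<forall>t\<in>space \<mu>. H (\<lambda>s. \<bar>f s\<bar>) t \<le> p t"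
      using decreasing_majorant[OF F fd] unfolding ces_nrm by blast
    let ?N = "{nrm E x * nrm ?M y | x y. x \<in> carr E \<and> y \<in> carr ?M \<and> (AE t in \<mu>. p t = x t * y t)}"
    have "?N \<noteq> {}" using p(2) unfolding C(2) product_space_def by auto
    moreover have "Inf ?N \<le> C * nrm F p" using C(3)[OF p(2)] by (simp add: product_space_def)
    \<comment> \<open>The infimum need not be attained. The norm of \<open>f\<close>, which is
      positive, serves as slack and so keeps the estimate homogeneous.\<close>
    then have "Inf ?N < C * nrm F p + nrm (ces F) f" using fpos by simp
    ultimately obtain z where "z \<in> ?N" "z < C * nrm F p + nrm (ces F) f" by (rule cInf_lessD[THEN bexE])
    then obtain g h where gh: "g \<in> carr E" "h \<in> carr ?M" "AE t in \<mu>. p t = g t * h t"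
        "nrm E g * nrm ?M h < C * nrm F p + nrm (ces F) f" by blast
    have "C * nrm F p \<le> C * (4 * nrm (ces F) f)" using C(1) p(3) by (intro mult_left_mono) auto
    then have gh_le: "nrm E g * nrm ?M h \<le> (4 * C + 1) * nrm (ces F) f"
      using gh(4) by (simp add: distrib_right)
    have M: "0 \<le> nrm ?M h" by (rule multipliers_nrm_nonneg[OF admissible_ideal[OF E] admissible_ideal[OF F] gh(2) eE])
    obtain w where w: "decreasing w"
      "\<forall>y\<in>carr E. decreasing y \<longrightarrow> (\<lambda>t. w t * y t) \<in> carr F \<and>
         nrm F (\<lambda>t. w t * y t) \<le> 2 * CF * nrm ?M h * nrm E y"
      "\<forall>p g. decreasing p \<longrightarrow> g \<in> carr E \<longrightarrow> (AE t in \<mu>. p t = g t * h t) \<longrightarrow>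
         (\<forall>t\<in>space \<mu>. p t \<le> 4 * w t * H (\<lambda>s. \<bar>g s\<bar>) t)"
      using factor_weight[OF E F gh(2) CF] by (elim exE conjE)
    have p_le: "p t \<le> 4 * w t * H (\<lambda>s. \<bar>g s\<bar>) t" if "t \<in> space \<mu>" for t
      using w(3) p(1) gh(1,3) that by blast
    \<comment> \<open>If \<open>w\<close> vanished at \<open>t\<close>, so would \<open>p\<close>
      from \<open>t\<close> on, hence H|f| from \<open>t\<close> on. As the integral of |f| over
      initial segments increases, H|f| would vanish everywhere, against the nonzero norm of
      \<open>f\<close>.\<close>
    have wpos: "0 < w t" if t: "t \<in> space \<mu>" for t
    proof (rule ccontr)
      assume "\<not> 0 < w t"
      then have "w t = 0" using decreasing_nonneg[OF w(1), of t] by simp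
      then have pt: "p t \<le> 0" using p_le[OF t] by simp
      have H0: "H (\<lambda>s. \<bar>f s\<bar>) u \<le> 0" if u: "u \<in> space \<mu>" "t \<le> u" for u
        using p(4) u pt decreasingD[OF p(1) t u] by fastforce
      have "H (\<lambda>s. \<bar>f s\<bar>) u \<le> 0" if u: "u \<in> space \<mu>" for u
      proof (cases "t \<le> u")
        case False
        then have "H (\<lambda>s. \<bar>f s\<bar>) u * m u \<le> H (\<lambda>s. \<bar>f s\<bar>) t * m t"
          by (intro H_mono_local[OF fd(1-3) u t]) simp
        also have "\<dots> \<le> 0" using H0[OF t] by (simp add: mult_nonpos_nonneg)
        finally show ?thesis using m_pos[OF u] by (simp add: mult_le_0_iff)
      qed (rule H0[OF u])
      then have "AE u in \<mu>. H (\<lambda>s. \<bar>f s\<bar>) u = 0"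
        using H_nonneg[OF fd(1-3)] by (intro AE_I2) (simp add: antisym)
      then show False using fpos F.nrm_zero_iff[OF fd(4)] by (simp add: ces_nrm)
    qed
    have gE: "(\<lambda>s. \<bar>g s\<bar>) \<in> carr E" "nrm E (\<lambda>s. \<bar>g s\<bar>) = nrm E g" using E.abs_mem[OF gh(1)] by auto
    have fm: "f \<in> borel_measurable \<mu>" using f by (simp add: ces_mem)
    have "H (\<lambda>s. \<bar>f s\<bar>) t \<le> 4 * w t * H (\<lambda>s. \<bar>g s\<bar>) t" if "t \<in> space \<mu>" for t
      using p(4) p_le[OF that] that by fastforce
    note x = quotient_in_ces[OF E w(1) wpos fm fd(3) admissible_H(2)[OF E gE(1)] _ this]
    have Hg: "nrm E (H (\<lambda>s. \<bar>g s\<bar>)) \<le> CE * nrm E g" using CE(2) gE by metis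
    define B where "B = 2 * CF * nrm ?M h"
    have B: "0 \<le> B" using CF(1) M by (simp add: B_def)
    have wm: "(\<lambda>t. w t * y t) \<in> carr (ces F) \<and> nrm (ces F) (\<lambda>t. w t * y t) \<le> 4 * CF * B * nrm (ces E) y"
      if "y \<in> carr (ces E)" for y
      by (rule weight_multiplies_ces[OF E F w(1) CF B _ that]) (use w(2) in \<open>simp add: B_def\<close>)
    have "nrm (ces E) (\<lambda>t. f t / w t) * (4 * CF * B) \<le> (4 * (CE * nrm E g)) * (4 * CF * B)"
      using x(2) Hg CF(1) B by (intro mult_right_mono) auto
    also have "\<dots> = 32 * CE * CF\<^sup>2 * (nrm E g * nrm ?M h)" by (simp add: B_def power2_eq_square)
    also have "\<dots> \<le> 32 * CE * CF\<^sup>2 * ((4 * C + 1) * nrm (ces F) f)"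
      using gh_le CE(1) by (intro mult_left_mono) auto
    finally have "nrm (ces E) (\<lambda>t. f t / w t) * (4 * CF * B) \<le> 32 * CE * CF\<^sup>2 * (4 * C + 1) * nrm (ces F) f"
      by (simp add: mult.assoc)
    moreover have "AE t in \<mu>. f t = f t / w t * w t" using wpos by (intro AE_I2) fastforce
    moreover have "(\<lambda>t. f t / w t) \<in> carr (ces E)" using x(1) by simp
    moreover have "0 \<le> 4 * CF * B" using CF(1) B by simp
    ultimately show "\<exists>x\<in>carr (ces E). \<exists>w\<in>borel_measurable \<mu>. \<exists>K\<ge>0.
        (AE t in \<mu>. f t = x t * w t) \<and>
        nrm (ces E) x * K \<le> 32 * CE * CF\<^sup>2 * (4 * C + 1) * nrm (ces F) f \<and>
        (\<forall>y\<in>carr (ces E). (\<lambda>t. w t * y t) \<in> carr (ces F) \<and> nrm (ces F) (\<lambda>t. w t * y t) \<le> K * nrm (ces E) y)"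
      using wm decreasing_measurable[OF w(1)]
      by (intro bexI[of _ "\<lambda>t. f t / w t"] bexI[of _ w] exI[of _ "4 * CF * B"] conjI ballI) auto
  qed
qed

end

subsection \<open>The half-line and the positive integers\<close>

lemma half_line_sets: "A \<in> sets half_line \<longleftrightarrow> A \<subseteq> {0<..} \<and> A \<in> sets lebesgue"
  by (rule sets_restrict_space_iff) simp

lemma half_line_emeasure: "A \<subseteq> {0<..} \<Longrightarrow> emeasure half_line A = emeasure lebesgue A"
  by (rule emeasure_restrict_space) auto

lemma half_line_init_seg: "init_seg half_line t = {0<..t}"
  by (auto simp: init_seg_def)

lemma half_line_init_seg_emeasure: "0 < t \<Longrightarrow> emeasure half_line (init_seg half_line t) = ennreal t"
  by (simp add: half_line_init_seg half_line_emeasure subset_iff)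

lemma half_line_init_seg_measure: "0 < t \<Longrightarrow> measure half_line (init_seg half_line t) = t"
  by (simp add: measure_def half_line_init_seg_emeasure)

text \<open>S \<union> (A \<inter> (0,u]) grows from \<open>S\<close> to \<open>A\<close>, and its
  measure is 1-Lipschitz in \<open>u\<close>; the intermediate value theorem picks
  \<open>u\<close>.\<close>

lemma half_line_intermediate:
  assumes t: "0 < t" and S: "S \<in> sets half_line" and A: "A \<in> sets half_line" and SA: "S \<subseteq> A"
    and le: "emeasure half_line S \<le> ennreal t" "ennreal t \<le> emeasure half_line A"
  shows "\<exists>B\<in>sets half_line. S \<subseteq> B \<and> B \<subseteq> A \<and> emeasure half_line B = ennreal t"
proof -
  have A': "A \<subseteq> {0<..}" "A \<in> sets lebesgue" and S': "S \<subseteq> {0<..}" "S \<in> sets lebesgue"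
    using A S by (auto simp: half_line_sets)
  have le': "emeasure lebesgue S \<le> ennreal t" "ennreal t \<le> emeasure lebesgue A"
    using le A'(1) S'(1) by (simp_all add: half_line_emeasure)
  define B where "B u = S \<union> (A \<inter> {0<..u})" for u :: real
  have Bsets: "B u \<in> sets lebesgue" for u unfolding B_def
    by (intro sets.Un sets.Int A'(2) S'(2)) simp
  have Bfm: "B u \<in> lmeasurable" for u
  proof -
    have "S \<in> lmeasurable" using S'(2) le'(1) by (intro fmeasurableI) (auto intro: le_less_trans)
    moreover have "A \<inter> {0<..u} \<in> lmeasurable"
      by (rule fmeasurableI2[of "{0..u}"]) (use A' in auto)
    ultimately show ?thesis unfolding B_def by (rule fmeasurable.Un)
  qed
  define G where "G u = measure lebesgue (B u)" for u
  have G_em: "emeasure lebesgue (B u) = ennreal (G u)" for u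
    unfolding G_def by (rule emeasure_eq_measure2[OF Bfm])
  have G_mono: "G u \<le> G v" if "u \<le> v" for u v
    unfolding G_def using that Bsets Bfm by (intro measure_mono_fmeasurable) (auto simp: B_def)
  have G_lip: "G v \<le> G u + (v - u)" if "u \<le> v" for u v
  proof -
    have "{u<..v} \<in> lmeasurable" by (rule fmeasurableI2[of "{u..v}"]) auto
    then have "G v \<le> measure lebesgue (B u \<union> {u<..v})"
      unfolding G_def using that Bsets Bfm
      by (intro measure_mono_fmeasurable fmeasurable.Un) (auto simp: B_def)
    also have "\<dots> \<le> measure lebesgue (B u) + measure lebesgue {u<..v}"
      using Bsets by (intro measure_Un_le) auto
    finally show ?thesis using that by (simp add: G_def)
  qed
  have cont: "continuous_on UNIV G"
  proof (rule lipschitz_on_continuous_on[OF lipschitz_onI])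
    show "dist (G x) (G y) \<le> 1 * dist x y" for x y
      using G_mono[of x y] G_mono[of y x] G_lip[of x y] G_lip[of y x]
      by (cases "x \<le> y") (auto simp: dist_real_def)
  qed simp
  show ?thesis
  \<comment> \<open>If \<open>A\<close> is unbounded, the measure \<open>t\<close> may be reached
    only in the limit; then \<open>A\<close> itself is the required set.\<close>
  proof (cases "emeasure lebesgue A = ennreal t")
    case True
    then show ?thesis using A SA A'(1) by (intro bexI[of _ A]) (auto simp: half_line_emeasure)
  next
    case False
    then have "ennreal t < emeasure lebesgue A" using le'(2) by simp
    also have "A = (\<Union>n. B (real n))"
      using SA A'(1) real_arch_simple by (fastforce simp: B_def)
    also have "emeasure lebesgue (\<Union>n. B (real n)) = (SUP n. emeasure lebesgue (B (real n)))"
      using Bsets by (intro SUP_emeasure_incseq[symmetric]) (auto simp: incseq_def B_def)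
    finally obtain n where "ennreal t < emeasure lebesgue (B (real n))" by (auto simp: less_SUP_iff)
    then have n: "t \<le> G (real n)" using t unfolding G_em by (simp add: ennreal_less_iff)
    have "B 0 = S" by (auto simp: B_def)
    then have "G 0 \<le> t" using le'(1) t G_em[of 0] by (simp add: ennreal_le_iff)
    then obtain u where "G u = t"
      using IVT'[of G 0 t "real n"] n continuous_on_subset[OF cont] by auto
    then have "emeasure lebesgue (B u) = ennreal t" using G_em by simp
    moreover have "B u \<subseteq> A" "S \<subseteq> B u" using SA by (auto simp: B_def)
    ultimately show ?thesis using A'(1) Bsets
      by (intro bexI[of _ "B u"]) (auto simp: half_line_emeasure half_line_sets)
  qed
qed

text \<open>At a continuity point a rational slightly to the right works, and a monotone function
  has only countably many discontinuities. The exception is genuine: at an irrational point right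
  after which \<open>z\<close> drops, every rational beyond it comes too late.\<close>

lemma half_line_rationals_dense:
  fixes z :: "real \<Rightarrow> real"
  assumes dec: "\<And>s t. 0 < s \<Longrightarrow> s \<le> t \<Longrightarrow> z t \<le> z s"
  shows "AE t in half_line. \<forall>e>0. \<exists>g\<in>\<rat> \<inter> {0<..}. t \<le> g \<and> z t - e < z g"
proof -
  let ?N = "{t \<in> {0<..}. \<not> isCont (\<lambda>t. - z t) t}"
  have "mono_on {0<..} (\<lambda>t. - z t)" using dec by (auto simp: monotone_on_def)
  then have "countable ?N" by (intro mono_on_ctble_discont_open) auto
  then have "?N \<in> null_sets lebesgue"
    using countable_imp_null_set_lborel null_sets_completionI by blast
  then have "?N \<in> null_sets half_line" by (subst null_sets_restrict_space) auto
  then have "AE t in half_line. t \<notin> ?N" by (rule AE_not_in)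
  then show ?thesis using AE_space
  proof eventually_elim
    case (elim t)
    then have t: "0 < t" "isCont (\<lambda>t. - z t) t" by auto
    show ?case
    proof (intro allI impI)
      fix e :: real assume "0 < e"
      then obtain d where d: "d > 0" "\<And>u. dist u t < d \<Longrightarrow> dist (- z u) (- z t) < e"
        using t(2) unfolding continuous_at_eps_delta by blast
      obtain g where g: "g \<in> \<rat>" "t < g" "g < t + d" using Rats_dense_in_real[of t "t + d"] d by auto
      then have "z t - e < z g" using d(2)[of g] by (auto simp: dist_real_def)
      then show "\<exists>g\<in>\<rat> \<inter> {0<..}. t \<le> g \<and> z t - e < z g" using g t(1) by (intro bexI[of _ g]) auto
    qed
  qed
qed

text \<open>Initial segments contain their right end point, whereas \<open>hardy\<close> integrates
  over the open interval; the difference is a null set.\<close>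

lemma half_line_integral:
  fixes x :: "real \<Rightarrow> real"
  assumes x: "x \<in> borel_measurable half_line" "\<And>s. 0 \<le> x s"
  shows "(\<integral>\<^sup>+s\<in>init_seg half_line t. ennreal (x s) \<partial>half_line) =
      (\<integral>\<^sup>+s. ennreal (indicator {0<..<t} s *\<^sub>R x s) \<partial>lebesgue)" (is "?A = ?B")
    and "(\<lambda>s. indicator {0<..<t} s *\<^sub>R x s) \<in> borel_measurable lebesgue"
proof -
  have "?A = (\<integral>\<^sup>+s. ennreal (x s) * indicator {0<..t} s * indicator {0<..} s \<partial>lebesgue)"
    unfolding half_line_init_seg by (rule nn_integral_restrict_space) simp
  also have "\<dots> = ?B"
  proof (rule nn_integral_cong_AE)
    have "{t} \<in> null_sets lebesgue" using countable_imp_null_set_lborel null_sets_completionI by blast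
    then have "AE s in lebesgue. s \<notin> {t}" by (rule AE_not_in)
    then show "AE s in lebesgue. ennreal (x s) * indicator {0<..t} s * indicator {0<..} s
       = ennreal (indicator {0<..<t} s *\<^sub>R x s)"
      by eventually_elim (auto simp: indicator_def)
  qed
  finally show "?A = ?B" .
  have "(\<lambda>s. indicator {0<..} s *\<^sub>R x s) \<in> borel_measurable lebesgue"
    by (rule iffD1[OF borel_measurable_restrict_space_iff x(1)]) simp
  then have "(\<lambda>s. indicator {0<..<t} s *\<^sub>R (indicator {0<..} s *\<^sub>R x s)) \<in> borel_measurable lebesgue"
    by (rule borel_measurable_scaleR[OF borel_measurable_indicator, rotated]) simp
  moreover have "(\<lambda>s. indicator {0<..<t} s *\<^sub>R (indicator {0<..} s *\<^sub>R x s)) = (\<lambda>s. indicator {0<..<t} s *\<^sub>R x s)"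
    by (auto simp: indicator_def)
  ultimately show "(\<lambda>s. indicator {0<..<t} s *\<^sub>R x s) \<in> borel_measurable lebesgue" by (simp only:)
qed

interpretation half_line: hardy_structure half_line hardy hardy_defined "\<lambda>t. t / 2" "\<rat> \<inter> {0<..}"
proof (unfold_locales, goal_cases)
  case (1 U)
  then have U: "U \<subseteq> {0<..}" by simp
  have "is_interval U" unfolding is_interval_1
  proof (intro ballI allI impI)
    fix a b c assume "a \<in> U" "b \<in> U" "a \<le> c \<and> c \<le> b"
    moreover from this U have "0 < c" by force
    ultimately show "c \<in> U" using 1(2)[of b c] by simp
  qed
  then have "U \<in> sets lebesgue" using real_interval_borel_measurable by auto
  then show ?case using U by (simp add: half_line_sets)
next
  case (2 t)
  then show ?case by (simp add: half_line_init_seg_emeasure)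
next
  case (3 t)
  then show ?case by (simp add: half_line_init_seg_emeasure)
next
  case (4 t)
  then show ?case by (intro bexI[of _ "2 * t"]) (auto simp: half_line_init_seg_measure)
next
  case (8 t)
  then show ?case by (simp add: half_line_init_seg_measure)
next
  case (9 t A)
  then have "emeasure half_line A < ennreal (t / 2)" by (simp add: half_line_init_seg_emeasure)
  then have "2 * emeasure half_line A \<le> ennreal 2 * ennreal (t / 2)" by (simp add: mult_left_mono)
  also have "\<dots> = ennreal t" using 9(1) by (subst ennreal_mult[symmetric]) auto
  finally show ?case using 9(1) by (simp add: half_line_init_seg_emeasure)
next
  case (10 t S A)
  then show ?case using half_line_intermediate[of t S A] by (simp add: half_line_init_seg_emeasure)
next
  case 11
  show ?case by (rule countable_Int1[OF countable_rat])
next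
  case 13
  have "(1::real) \<in> \<rat> \<inter> {0<..}" by simp
  then show ?case by blast
next
  case (14 z)
  then show ?case by (intro half_line_rationals_dense) auto
next
  case (15 x t)
  then have "0 \<le> (LINT s:{0<..<t}|lebesgue. x s)" unfolding set_lebesgue_integral_def by simp
  then show ?case using 15 by (simp add: hardy_def)
next
  case (16 x t)
  then have "integrable lebesgue (\<lambda>s. indicator {0<..<t} s *\<^sub>R x s)"
    by (simp add: hardy_defined_def set_integrable_def)
  from nn_integral_eq_integral[OF this] half_line_integral(1)[OF 16(1,2), of t] 16
  show ?case by (simp add: hardy_def set_lebesgue_integral_def half_line_init_seg_measure)
next
  case (17 x)
  have "set_integrable lebesgue {0<..<t} x \<longleftrightarrow>
      (\<integral>\<^sup>+s\<in>init_seg half_line t. ennreal (x s) \<partial>half_line) < \<infinity>" for t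
    unfolding set_integrable_def integrable_iff_bounded half_line_integral(1)[OF 17]
    using half_line_integral(2)[OF 17, of t] 17(2) by simp
  then show ?case by (auto simp: hardy_defined_def)
qed auto

section \<open>The positive integers with counting measure\<close>

lemma pos_nats_init_seg: "init_seg pos_nats n = {1..n}"
  by (auto simp: init_seg_def)

lemma pos_nats_emeasure:
  "A \<subseteq> {1..} \<Longrightarrow> emeasure pos_nats A = (if finite A then of_nat (card A) else \<infinity>)"
  by (rule emeasure_count_space)

lemma pos_nats_init_seg_emeasure: "emeasure pos_nats (init_seg pos_nats n) = of_nat n"
  unfolding pos_nats_init_seg by (subst pos_nats_emeasure) auto

lemma pos_nats_init_seg_measure: "measure pos_nats (init_seg pos_nats n) = real n"
  by (simp add: measure_def pos_nats_init_seg_emeasure del: One_nat_def)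

lemma pos_nats_intermediate:
  assumes S: "S \<subseteq> A" and A: "A \<subseteq> {1..}"
    and le: "emeasure pos_nats S \<le> of_nat n" "of_nat n \<le> emeasure pos_nats A"
  shows "\<exists>B. S \<subseteq> B \<and> B \<subseteq> A \<and> emeasure pos_nats B = of_nat n"
proof -
  have fS: "finite S" "card S \<le> n"
    using le(1) S A pos_nats_emeasure[of S] by (auto split: if_splits simp: top_unique)
  \<comment> \<open>\<open>A\<close> may be infinite, so a finite set with enough points is inserted
    between \<open>S\<close> and \<open>A\<close> before \<open>B\<close> is chosen.\<close>
  have "\<exists>C. finite C \<and> S \<subseteq> C \<and> C \<subseteq> A \<and> n \<le> card C"
  proof (cases "finite A")
    case True
    then show ?thesis using le(2) pos_nats_emeasure[OF A] S by (intro exI[of _ A]) auto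
  next
    case False
    then obtain C where "C \<subseteq> A" "finite C" "card C = n" using infinite_arbitrarily_large by blast
    then show ?thesis using fS S by (intro exI[of _ "S \<union> C"]) (auto intro: card_mono)
  qed
  then obtain C where C: "finite C" "S \<subseteq> C" "C \<subseteq> A" "n \<le> card C" by blast
  obtain B where B: "S \<subseteq> B" "B \<subseteq> C" "card B = n"
    using exists_subset_between[OF fS(2) C(4,2,1)] by blast
  then have "emeasure pos_nats B = of_nat n"
    using C A finite_subset[OF B(2) C(1)] pos_nats_emeasure[of B] by auto
  then show ?thesis using B C(3) by blast
qed

lemma pos_nats_integral:
  assumes "\<And>s. 0 \<le> x s"
  shows "(\<integral>\<^sup>+s\<in>init_seg pos_nats n. ennreal (x s) \<partial>pos_nats) = ennreal (\<Sum>s=1..n. x s)"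
proof -
  have "(\<integral>\<^sup>+s\<in>init_seg pos_nats n. ennreal (x s) \<partial>pos_nats) = (\<Sum>s=1..n. ennreal (x s) * indicator {1..n} s)"
    unfolding pos_nats_init_seg by (rule nn_integral_count_space') auto
  also have "\<dots> = ennreal (\<Sum>s=1..n. x s)" using assms by (simp flip: sum_ennreal)
  finally show ?thesis .
qed

text \<open>Finite sums always exist, so \<open>Hd\<close> is constantly true; with all points in
  \<open>D\<close>, the point \<open>t\<close> itself witnesses \<open>D_dense\<close>.\<close>

interpretation pos_nats: hardy_structure pos_nats hardy_seq "\<lambda>_. True" "\<lambda>n. (n + 1) div 2" "{1..}"
proof (unfold_locales, goal_cases)
  case (2 t)
  then show ?case unfolding pos_nats_init_seg_emeasure by simp
next
  case (3 t)
  show ?case unfolding pos_nats_init_seg_emeasure by (simp add: of_nat_less_top)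
next
  case (4 t)
  then show ?case by (intro bexI[of _ "2 * t"]) (unfold pos_nats_init_seg_measure, auto)
next
  case (8 t)
  \<comment> \<open>Rounding up matters: for odd \<open>t\<close> rounding down would violate this
    inequality, and for t = 1 it would leave the space.\<close>
  show ?case unfolding pos_nats_init_seg_measure by linarith
next
  case (9 t A)
  have A: "A \<subseteq> {1..}" using 9(2) by auto
  have fin: "finite A" and "card A < (t + 1) div 2"
    using 9(3) unfolding pos_nats_emeasure[OF A] pos_nats_init_seg_emeasure by (auto split: if_splits)
  then have "2 * card A \<le> t" by simp
  then have "of_nat (2 * card A) \<le> (of_nat t :: ennreal)" by (simp only: of_nat_le_iff)
  then show ?case using fin unfolding pos_nats_emeasure[OF A] pos_nats_init_seg_emeasure by simp
next
  case (10 t S A)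
  have "A \<subseteq> {1..}" using 10(3) by simp
  from pos_nats_intermediate[OF 10(4) this] 10(5,6)
  obtain B where B: "S \<subseteq> B" "B \<subseteq> A" "emeasure pos_nats B = of_nat t"
    unfolding pos_nats_init_seg_emeasure by blast
  then show ?case using 10(3) unfolding pos_nats_init_seg_emeasure by (intro bexI[of _ B]) auto
next
  case (14 z)
  show ?case by (rule AE_I2) (auto intro!: bexI)
next
  case (15 x t)
  then show ?case by (simp add: hardy_seq_def sum_nonneg)
next
  case (16 x t)
  then show ?case
    unfolding pos_nats_integral[OF 16(2)] pos_nats_init_seg_measure by (simp add: hardy_seq_def)
next
  case (17 x)
  show ?case unfolding pos_nats_integral[OF 17(2)] by simp
qed auto

lemma half_line_admissible:
  "half_line.admissible E \<longleftrightarrow>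
    symmetric_banach_space half_line E \<and> fatou_property half_line E \<and> hardy_bounded E"
  by (auto simp: half_line.admissible_def hardy_bounded_def)

lemma pos_nats_admissible:
  "pos_nats.admissible E \<longleftrightarrow>
    symmetric_banach_space pos_nats E \<and> fatou_property pos_nats E \<and> hardy_seq_bounded E"
  unfolding pos_nats.admissible_def hardy_seq_bounded_def by blast

lemma half_line_ces: "half_line.ces E = cesaro E"
  by (simp add: half_line.ces_def cesaro_def)

lemma pos_nats_ces: "pos_nats.ces E = cesaro_seq E"
  unfolding pos_nats.ces_def cesaro_seq_def by simp

theorem corollary4:
  "(\<forall>(E :: real fspace) (F :: real fspace).
      symmetric_banach_space half_line E \<and> symmetric_banach_space half_line F \<and>
      fatou_property half_line E \<and> fatou_property half_line F \<and>
      hardy_bounded E \<and> hardy_bounded F \<and>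
      same_space F (product_space half_line E (multipliers half_line E F)) \<longrightarrow>
      same_space (cesaro F)
        (product_space half_line (cesaro E) (multipliers half_line (cesaro E) (cesaro F)))) \<and>
   (\<forall>(E :: nat fspace) (F :: nat fspace).
      symmetric_banach_space pos_nats E \<and> symmetric_banach_space pos_nats F \<and>
      fatou_property pos_nats E \<and> fatou_property pos_nats F \<and>
      hardy_seq_bounded E \<and> hardy_seq_bounded F \<and>
      same_space F (product_space pos_nats E (multipliers pos_nats E F)) \<longrightarrow>
      same_space (cesaro_seq F)
        (product_space pos_nats (cesaro_seq E)
           (multipliers pos_nats (cesaro_seq E) (cesaro_seq F))))"
  using half_line.ces_factorization pos_nats.ces_factorization
  unfolding half_line_admissible half_line_ces pos_nats_admissible pos_nats_ces by blast

end
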